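(* Let $\mathcal{X}\subset\mathbb{R}^n$ be the finite state space of binary vectors or of one-hot encoded categorical vectors, let $r\ge 1$ be an integer, and for $x\in\mathcal{X}$ let $H(x)\subset\mathcal{X}$ be the Hamming ball of size $r$ around $x$. Let $f:\mathbb{R}^n\to\mathbb{R}$ be differentiable and $L$-smooth, i.e. $\|\nabla f(u)-\nabla f(v)\|\le L\|u-v\|$ for all $u,v\in\mathbb{R}^n$, and let $p(x)=e^{f(x)}/Z$ for $x\in\mathcal{X}$, where $Z=\sum_{x\in\mathcal{X}}e^{f(x)}$. Let $Q$ and $Q^\nabla$ be the Markov transition kernels on $\mathcal{X}$ given by the Metropolis-Hastings algorithm with target $p$ using, respectively, the locally balanced proposal $$q_2(x'|x)=\frac{e^{\frac12(f(x')-f(x))}\,\mathbf{1}(x'\in H(x))}{\sum_{y\in H(x)}e^{\frac12(f(y)-f(x))}}$$ and the gradient-based proposal $$q^\nabla(x'|x)=\frac{e^{\frac12\nabla f(x)^T(x'-x)}\,\mathbf{1}(x'\in H(x))}{\sum_{y\in H(x)}e^{\frac12\nabla f(x)^T(y-x)}}.$$ Put $D_H=\sup_{x'\in H(x)}\|x-x'\|$ and $c=e^{-\frac12 L D_H^2}$. Then: (a) for every function $h:\mathcal{X}\to\mathbb{R}$, $$\mathrm{var}_p(h,Q^\nabla)\le \frac{\mathrm{var}_p(h,Q)}{c}+\frac{1-c}{c}\cdot\mathrm{var}_p(h);$$ (b) $\mathrm{Gap}(Q^\nabla)\ge c\cdot\mathrm{Gap}(Q)$.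
   Context: State space. Either $\mathcal{X}=\{0,1\}^D\subset\mathbb{R}^n$ with $n=D$ (binary data), or $\mathcal{X}$ is the set of $D$-tuples of one-hot vectors in $\mathbb{R}^K$ ($K\ge 2$ categories), viewed as a subset of $\mathbb{R}^n$ with $n=DK$ (categorical data); $D\ge 1$. $\|\cdot\|$ is the Euclidean norm. Hamming ball. $H(x)$ consists of the states $x'\in\mathcal{X}$ that differ from $x$ in at most $r$ of the $D$ variables. (The center $x$ itself may be either included in all the $H(x)$ or excluded from all of them; the same convention is used for both proposals, and the result is meant for either convention.) By symmetry, the value $\sup_{x'\in H(x)}\|x-x'\|$ does not depend on $x\in\mathcal{X}$, so $D_H$ is a well-defined constant. Metropolis-Hastings kernel. For a proposal $q(x'|x)$ and target $p$, the transition kernel $K(x',x)$ denotes the probability of moving from $x$ to $x'$. For $x'\ne x$ with $q(x'|x)>0$ it equals $$K(x',x)=q(x'|x)\min\left\{1,\frac{p(x')\,q(x|x')}{p(x)\,q(x'|x)}\right\},$$ it is $0$ for $x'\neq x$ with $q(x'|x)=0$, and the remaining probability is assigned to staying at $x$. Asymptotic variance. For a $p$-stationary Markov kernel $Q$ and $h:\mathcal{X}\to\mathbb{R}$, $$\mathrm{var}_p(h,Q)=\lim_{T\to\infty}\frac1T\,\mathrm{var}\left(\sum_{t=1}^T h(X_t)\right),$$ where $(X_t)_{t\ge1}$ is the Markov chain with kernel $Q$ started from $X_1\sim p$. Also $\mathrm{var}_p(h)=E_p[h(x)^2]-E_p[h(x)]^2$. Spectral gap. $\mathrm{Gap}(Q)=1-\lambda_2$,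 where $\lambda_2$ is the second largest eigenvalue (counted with multiplicity) of the transition probability matrix of $Q$. *)

theory Defs
  imports "HOL-Probability.Probability" "Jordan_Normal_Form.Char_Poly"
begin

no_notation Matrix.vec_index (infixl "$" 100)

section \<open>State spaces\<close>

definition binary_states :: "(real ^ 'd) set" where
  "binary_states = {x. \<forall>i. x $ i = 0 \<or> x $ i = 1}"

text \<open>\<^typ>\<open>real ^ 'k ^ 'd\<close> is Euclidean space of dimension \<open>CARD('d) * CARD('k)\<close>: its inner product
  and norm are those of the flattened vector, and \<open>x $ i\<close> is the block of the variable \<open>i\<close>.\<close>

definition onehot_states :: "(real ^ 'k ^ 'd) set" where
  "onehot_states = {x. \<forall>i. \<exists>k. x $ i = axis k 1}"

definition hamming :: "'a ^ 'd \<Rightarrow> 'a ^ 'd \<Rightarrow> nat" where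
  "hamming x y = card {i. x $ i \<noteq> y $ i}"

text \<open>The flag \<open>cen\<close> says whether the center \<open>x\<close> belongs to its own Hamming ball.\<close>

definition hamming_ball :: "('a ^ 'd) set \<Rightarrow> bool \<Rightarrow> nat \<Rightarrow> 'a ^ 'd \<Rightarrow> ('a ^ 'd) set" where
  "hamming_ball S cen r x = {x' \<in> S. hamming x x' \<le> r \<and> (x' = x \<longrightarrow> cen)}"

definition ball_radius :: "('a::real_normed_vector \<Rightarrow> 'a set) \<Rightarrow> 'a \<Rightarrow> real" where
  "ball_radius H x = (SUP x'\<in>H x. norm (x - x'))"

section \<open>Target and proposals\<close>

text \<open>\<open>g\<close> is the gradient of \<open>f\<close>, which in particular is differentiable.\<close>

definition L_smooth :: "('a::real_inner \<Rightarrow> real) \<Rightarrow> ('a \<Rightarrow> 'a) \<Rightarrow> real \<Rightarrow> bool" where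
  "L_smooth f g L \<longleftrightarrow>
     (\<forall>u. GDERIV f u :> g u) \<and> (\<forall>u v. norm (g u - g v) \<le> L * norm (u - v))"

definition gibbs :: "'a set \<Rightarrow> ('a \<Rightarrow> real) \<Rightarrow> 'a pmf" where
  "gibbs S f = embed_pmf (\<lambda>x. if x \<in> S then exp (f x) / (\<Sum>y\<in>S. exp (f y)) else 0)"

text \<open>A proposal is written \<open>q x' x\<close> for the probability \<open>q(x'|x)\<close> of proposing \<open>x'\<close> from \<open>x\<close>.\<close>

definition balanced_proposal :: "('a \<Rightarrow> 'a set) \<Rightarrow> ('a \<Rightarrow> real) \<Rightarrow> 'a \<Rightarrow> 'a \<Rightarrow> real" where
  "balanced_proposal H f x' x =
     exp ((f x' - f x) / 2) * indicator (H x) x' / (\<Sum>y\<in>H x. exp ((f y - f x) / 2))"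

definition gradient_proposal ::
    "('a::real_inner \<Rightarrow> 'a set) \<Rightarrow> ('a \<Rightarrow> 'a) \<Rightarrow> 'a \<Rightarrow> 'a \<Rightarrow> real" where
  "gradient_proposal H g x' x =
     exp (inner (g x) (x' - x) / 2) * indicator (H x) x' / (\<Sum>y\<in>H x. exp (inner (g x) (y - x) / 2))"

section \<open>Metropolis-Hastings kernel\<close>

definition mh_move :: "'a pmf \<Rightarrow> ('a \<Rightarrow> 'a \<Rightarrow> real) \<Rightarrow> 'a \<Rightarrow> 'a \<Rightarrow> real" where
  "mh_move p q x' x =
     (if q x' x > 0 then q x' x * min 1 (pmf p x' * q x x' / (pmf p x * q x' x)) else 0)"

definition mh_kernel :: "'a set \<Rightarrow> 'a pmf \<Rightarrow> ('a \<Rightarrow> 'a \<Rightarrow> real) \<Rightarrow> 'a \<Rightarrow> 'a pmf" where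
  "mh_kernel S p q x =
     embed_pmf (\<lambda>x'. if x' = x then 1 - (\<Sum>y\<in>S - {x}. mh_move p q y x) else mh_move p q x' x)"

section \<open>Asymptotic variance\<close>

text \<open>Law of the first \<open>T\<close> states of the chain with kernel \<open>Q\<close> started at \<open>x\<close>; the state drawn after
  the last one is discarded.\<close>

primrec path_from :: "('a \<Rightarrow> 'a pmf) \<Rightarrow> nat \<Rightarrow> 'a \<Rightarrow> 'a list pmf" where
  "path_from Q 0 x = return_pmf []"
| "path_from Q (Suc T) x = bind_pmf (Q x) (\<lambda>y. map_pmf ((#) x) (path_from Q T y))"

definition path_law :: "'a pmf \<Rightarrow> ('a \<Rightarrow> 'a pmf) \<Rightarrow> nat \<Rightarrow> 'a list pmf" where
  "path_law p Q T = bind_pmf p (path_from Q T)"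

definition asymptotic_variance :: "'a pmf \<Rightarrow> ('a \<Rightarrow> real) \<Rightarrow> ('a \<Rightarrow> 'a pmf) \<Rightarrow> real" where
  "asymptotic_variance p h Q =
     lim (\<lambda>T. measure_pmf.variance (path_law p Q T) (\<lambda>xs. \<Sum>x\<leftarrow>xs. h x) / real T)"

definition target_variance :: "'a pmf \<Rightarrow> ('a \<Rightarrow> real) \<Rightarrow> real" where
  "target_variance p h =
     measure_pmf.expectation p (\<lambda>x. (h x)\<^sup>2) - (measure_pmf.expectation p h)\<^sup>2"

section \<open>Spectral gap\<close>

text \<open>The states are numbered by \<^const>\<open>from_nat_into\<close>, a bijection from \<open>{..<card S}\<close> onto a finite \<open>S\<close>;
  the spectrum does not depend on the numbering.  Entry \<open>(i, j)\<close> is the probability of moving from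
  state \<open>i\<close> to state \<open>j\<close>.\<close>

definition transition_matrix :: "'a set \<Rightarrow> ('a \<Rightarrow> 'a pmf) \<Rightarrow> real mat" where
  "transition_matrix S Q =
     Matrix.mat (card S) (card S) (\<lambda>(i, j). pmf (Q (from_nat_into S i)) (from_nat_into S j))"

text \<open>The real eigenvalues in decreasing order, repeated according to algebraic multiplicity.
  A Metropolis-Hastings kernel is reversible, so all eigenvalues of its matrix are real.\<close>

definition eigenvalues_desc :: "real mat \<Rightarrow> real list" where
  "eigenvalues_desc A = rev (sorted_list_of_multiset (proots (char_poly A)))"

definition spectral_gap :: "'a set \<Rightarrow> ('a \<Rightarrow> 'a pmf) \<Rightarrow> real" where
  "spectral_gap S Q = 1 - eigenvalues_desc (transition_matrix S Q) ! 1"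

section \<open>The weights above are probability mass functions\<close>

lemma pmf_embed_finite:
  assumes "finite S" "\<And>x. 0 \<le> w x" "\<And>x. x \<notin> S \<Longrightarrow> w x = 0" "(\<Sum>x\<in>S. w x) = 1"
  shows "pmf (embed_pmf w) x = w x"
proof (rule pmf_embed_pmf)
  have "(\<integral>\<^sup>+x. ennreal (w x) \<partial>count_space UNIV) = (\<Sum>x\<in>S. ennreal (w x))"
    using assms(1,3) by (intro nn_integral_count_space') auto
  then show "(\<integral>\<^sup>+x. ennreal (w x) \<partial>count_space UNIV) = 1"
    using assms(2,4) by (simp add: sum_ennreal)
qed (use assms in auto)

lemma pmf_gibbs:
  assumes "finite S" "S \<noteq> {}"
  shows "pmf (gibbs S f) x = (if x \<in> S then exp (f x) / (\<Sum>y\<in>S. exp (f y)) else 0)"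
proof -
  have "(\<Sum>y\<in>S. exp (f y)) > 0"
    using assms by (intro sum_pos) auto
  then show ?thesis
    unfolding gibbs_def using assms(1)
    by (subst pmf_embed_finite[of S]) (auto simp flip: sum_divide_distrib)
qed

lemma pmf_mh_kernel:
  assumes "finite S" "x \<in> S" and q: "\<And>y z. 0 \<le> q y z" "\<And>y. y \<notin> S \<Longrightarrow> q y x = 0"
    and le: "(\<Sum>y\<in>S. q y x) \<le> 1"
  shows "pmf (mh_kernel S p q x) x' =
    (if x' = x then 1 - (\<Sum>y\<in>S - {x}. mh_move p q y x) else mh_move p q x' x)"
proof -
  have nonneg: "0 \<le> mh_move p q y x" for y
    using q(1) by (auto simp: mh_move_def)
  have "mh_move p q y x \<le> q y x" for y
    using q(1)[of y x] by (auto simp: mh_move_def mult_left_le)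
  then have "(\<Sum>y\<in>S - {x}. mh_move p q y x) \<le> (\<Sum>y\<in>S - {x}. q y x)"
    by (rule sum_mono)
  also have "\<dots> \<le> (\<Sum>y\<in>S. q y x)"
    using assms(1) q(1) by (intro sum_mono2) auto
  finally have "(\<Sum>y\<in>S - {x}. mh_move p q y x) \<le> 1"
    using le by simp
  moreover have "mh_move p q y x = 0" if "y \<notin> S" for y
    using q(2)[OF that] by (simp add: mh_move_def)
  ultimately show ?thesis
    unfolding mh_kernel_def using assms(1,2) nonneg
    by (subst pmf_embed_finite[of S]) (auto simp: sum.remove)
qed

end

theory Submission
  imports Defs
begin

text \<open>Let \<open>u\<close> solve the Poisson equation \<open>u - Q u = h - E h\<close>. Summing covariances telescopes, so the
  asymptotic variance is \<open>2 \<langle>h - E h, u\<rangle> - var h\<close>, whether or not the chain is periodic. By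
  self-adjointness \<open>\<langle>h - E h, u\<rangle>\<close> is the value at \<open>u\<close> of the Dirichlet form of \<open>Q\<close>, and the spectral gap
  is the minimum of the Dirichlet form over mean-zero functions of norm one. Both therefore compare
  as soon as the off-diagonal entries of the two kernels do. These compare with factor
  \<open>exp (- L D\<^sup>2 / 2)\<close> because the first-order Taylor error of \<open>f\<close> is at most \<open>L D\<^sup>2 / 2\<close>, so that numerator
  and normalizing constant of the proposals each change by a factor of at most \<open>exp (L D\<^sup>2 / 4)\<close>.\<close>

section \<open>Matrices indexed by a finite set\<close>

text \<open>The two Poisson equations have different solutions, so their Dirichlet values are not
  taken at a common function. The comparison goes through \<open>2 <h, phi> - D(phi, phi)\<close>
  for centered \<open>h\<close>, whose maximum over \<open>phi\<close> is the value at the solution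
  and which reverses the order of the forms. The gap is defined by a list of roots with algebraic
  multiplicity. Instead of diagonalizing, it suffices that 1 is a simple root and that the largest
  Rayleigh quotient on mean-zero functions is an eigenvalue bounding every other real root.
  Periodicity does occur: with one binary variable, constant \<open>f\<close> and the center
  excluded, the chain alternates between two states. Powers of the kernel then do not converge, so
  \<open>u\<close> is found by linear algebra rather than as a series.\<close>

definition mat_on :: "'a set \<Rightarrow> ('a \<Rightarrow> 'a \<Rightarrow> real) \<Rightarrow> real mat" where
  "mat_on S a = Matrix.mat (card S) (card S) (\<lambda>(i, j). a (from_nat_into S i) (from_nat_into S j))"

lemma mat_on_carrier [simp]: "mat_on S a \<in> carrier_mat (card S) (card S)"
  by (simp add: mat_on_def)

text \<open>The enumeration is that of \<open>transition_matrix\<close>, which is thus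
  \<open>mat_on S\<close> of the kernel. Matrix theory can then be restated through functions on
  \<open>S\<close>, without indices.\<close>

definition vec_on :: "'a set \<Rightarrow> ('a \<Rightarrow> real) \<Rightarrow> real Matrix.vec" where
  "vec_on S \<phi> = Matrix.vec (card S) (\<lambda>i. \<phi> (from_nat_into S i))"

lemma vec_on_carrier [simp]: "vec_on S \<phi> \<in> carrier_vec (card S)"
  by (simp add: vec_on_def)

lemma vec_on_surj:
  assumes "finite S" "v \<in> carrier_vec (card S)"
  obtains \<phi> where "v = vec_on S \<phi>"
proof -
  have bij: "bij_betw (from_nat_into S) {..<card S} S"
    using assms(1) by (rule bij_betw_from_nat_into_finite)
  have "v = vec_on S (\<lambda>x. vec_index v (the_inv_into {..<card S} (from_nat_into S) x))"
    using assms(2) the_inv_into_f_f[OF bij_betw_imp_inj_on[OF bij]]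
    by (intro eq_vecI) (auto simp: vec_on_def)
  then show thesis by (rule that)
qed

lemma vec_on_eq_iff:
  assumes "finite S"
  shows "vec_on S \<phi> = vec_on S \<psi> \<longleftrightarrow> (\<forall>x\<in>S. \<phi> x = \<psi> x)"
proof -
  have S: "S = from_nat_into S ` {..<card S}"
    using bij_betw_from_nat_into_finite[OF assms] by (simp add: bij_betw_def)
  have "vec_on S \<phi> = vec_on S \<psi> \<longleftrightarrow> (\<forall>i\<in>{..<card S}. \<phi> (from_nat_into S i) = \<psi> (from_nat_into S i))"
    by (auto simp: vec_on_def vec_eq_iff)
  also have "\<dots> \<longleftrightarrow> (\<forall>x\<in>S. \<phi> x = \<psi> x)"
    by (subst (4) S) blast
  finally show ?thesis .
qed

lemma mat_on_mult_vec_on: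
  assumes "finite S"
  shows "mat_on S a *\<^sub>v vec_on S \<phi> = vec_on S (\<lambda>x. \<Sum>y\<in>S. a x y * \<phi> y)"
proof (rule eq_vecI)
  fix i assume "i < dim_vec (vec_on S (\<lambda>x. \<Sum>y\<in>S. a x y * \<phi> y))"
  then have i: "i < card S" by (simp add: vec_on_def)
  have "(\<Sum>j = 0..<card S. a (from_nat_into S i) (from_nat_into S j) * \<phi> (from_nat_into S j)) =
      (\<Sum>y\<in>S. a (from_nat_into S i) y * \<phi> y)"
    using sum.reindex_bij_betw[OF bij_betw_from_nat_into_finite[OF assms],
        of "\<lambda>y. a (from_nat_into S i) y * \<phi> y"]
    by (simp add: atLeast0LessThan)
  then show "vec_index (mat_on S a *\<^sub>v vec_on S \<phi>) i =
      vec_index (vec_on S (\<lambda>x. \<Sum>y\<in>S. a x y * \<phi> y)) i"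
    using i by (simp add: mat_on_def vec_on_def scalar_prod_def)
qed (simp add: mat_on_def vec_on_def)

lemma eigenvalue_mat_on_iff:
  assumes "finite S"
  shows "eigenvalue (mat_on S a) k \<longleftrightarrow>
    (\<exists>\<phi>. (\<exists>x\<in>S. \<phi> x \<noteq> 0) \<and> (\<forall>x\<in>S. (\<Sum>y\<in>S. a x y * \<phi> y) = k * \<phi> x))"
proof -
  have zero: "0\<^sub>v (card S) = vec_on S (\<lambda>_. 0)"
    by (auto simp: vec_on_def)
  have smult: "k \<cdot>\<^sub>v vec_on S \<phi> = vec_on S (\<lambda>x. k * \<phi> x)" for \<phi>
    by (auto simp: vec_on_def)
  have dim: "dim_row (mat_on S a) = card S"
    by (simp add: mat_on_def)
  have "eigenvector (mat_on S a) (vec_on S \<phi>) k \<longleftrightarrow>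
      (\<exists>x\<in>S. \<phi> x \<noteq> 0) \<and> (\<forall>x\<in>S. (\<Sum>y\<in>S. a x y * \<phi> y) = k * \<phi> x)" for \<phi>
    unfolding eigenvector_def dim zero smult mat_on_mult_vec_on[OF assms] vec_on_eq_iff[OF assms]
    by auto
  moreover have "eigenvalue (mat_on S a) k \<longleftrightarrow> (\<exists>\<phi>. eigenvector (mat_on S a) (vec_on S \<phi>) k)"
    unfolding eigenvalue_def by (metis eigenvector_def dim vec_on_surj[OF assms])
  ultimately show ?thesis by simp
qed

text \<open>For a square matrix a trivial null space forces a nonzero determinant and hence an
  inverse. This yields solutions of the Poisson equation.\<close>

lemma injective_imp_solvable_on:
  fixes a :: "'a \<Rightarrow> 'a \<Rightarrow> real"
  assumes "finite S"
    and inj: "\<And>\<phi>. (\<And>x. x \<in> S \<Longrightarrow> (\<Sum>y\<in>S. a x y * \<phi> y) = 0) \<Longrightarrow> \<forall>x\<in>S. \<phi> x = 0"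
  shows "\<exists>u. \<forall>x\<in>S. (\<Sum>y\<in>S. a x y * u y) = h x"
proof -
  let ?A = "mat_on S a" and ?n = "card S"
  have zero: "0\<^sub>v ?n = vec_on S (\<lambda>_. 0)"
    by (auto simp: vec_on_def)
  have "v = 0\<^sub>v ?n" if v: "v \<in> carrier_vec ?n" and eq: "?A *\<^sub>v v = 0\<^sub>v ?n" for v
  proof -
    obtain \<phi> where \<phi>: "v = vec_on S \<phi>"
      using vec_on_surj[OF assms(1) v] .
    show ?thesis
      using eq inj unfolding \<phi> zero mat_on_mult_vec_on[OF assms(1)] vec_on_eq_iff[OF assms(1)]
      by blast
  qed
  then have "det ?A \<noteq> 0"
    using det_0_iff_vec_prod_zero_field[of ?A ?n] by auto
  then have "?A \<in> Units (ring_mat TYPE(real) ?n ())"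
    by (intro det_non_zero_imp_unit) auto
  then obtain B where B: "B \<in> carrier_mat ?n ?n" and AB: "?A * B = 1\<^sub>m ?n"
    by (auto simp: Units_def ring_mat_simps)
  obtain u where u: "B *\<^sub>v vec_on S h = vec_on S u"
    using vec_on_surj[OF assms(1), of "B *\<^sub>v vec_on S h"] B by auto
  have "?A *\<^sub>v (B *\<^sub>v vec_on S h) = (?A * B) *\<^sub>v vec_on S h"
    by (rule assoc_mult_mat_vec[OF mat_on_carrier B vec_on_carrier, symmetric])
  also have "\<dots> = vec_on S h"
    unfolding AB by simp
  finally have "vec_on S (\<lambda>x. \<Sum>y\<in>S. a x y * u y) = vec_on S h"
    unfolding u mat_on_mult_vec_on[OF assms(1)] .
  then show ?thesis
    unfolding vec_on_eq_iff[OF assms(1)] by blast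
qed

text \<open>\<open>mat_erase\<close> overwrites a row and a column by zeros and keeps the dimension,
  so erasing a diagonal position describes the chain killed at that state.\<close>

lemma mat_erase_mat_on:
  assumes "finite S" "i < card S"
  shows "mat_erase (mat_on S a) i i =
    mat_on S (\<lambda>x y. if x = from_nat_into S i \<or> y = from_nat_into S i then 0 else a x y)"
proof -
  have "from_nat_into S j = from_nat_into S i \<longleftrightarrow> j = i" if "j < card S" for j
    using bij_betw_imp_inj_on[OF bij_betw_from_nat_into_finite[OF assms(1)]] assms(2) that
    by (auto simp: inj_on_def)
  then show ?thesis
    using assms(2) by (intro eq_matI) (auto simp: mat_erase_def mat_on_def)
qed

section \<open>Real roots of polynomials\<close>

text \<open>A monic polynomial is eventually positive, so a negative value at \<open>s\<close> would
  force a root beyond \<open>s\<close>.\<close>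

lemma monic_poly_pos:
  fixes q :: "real poly"
  assumes "lead_coeff q = 1" "\<And>t. t \<ge> s \<Longrightarrow> poly q t \<noteq> 0"
  shows "poly q s > 0"
proof (rule ccontr)
  assume "\<not> poly q s > 0"
  then have neg: "poly q s < 0" using assms(2)[of s] by force
  obtain m where m: "\<And>t. t \<ge> m \<Longrightarrow> poly q t \<ge> 1"
    using poly_pinfty_gt_lc[of q] assms(1) by auto
  have "poly q (max m (s + 1)) > 0"
    using m[of "max m (s + 1)"] by auto
  then obtain t where "s < t" "poly q t = 0"
    using poly_IVT_pos[OF _ neg, of "max m (s + 1)"] by (auto simp: max_def split: if_splits)
  then show False using assms(2)[of t] by simp
qed

text \<open>Only the largest element \<open>b\<close> has to be simple, whatever the multiplicities
  of \<open>a\<close> and of the smaller elements. For the spectrum, \<open>b\<close> is 1.\<close>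

lemma nth_rev_sorted_list_of_multiset:
  fixes M :: "real multiset"
  assumes "count M b = 1" "a \<in># M" "a < b" "\<And>t. t \<in># M \<Longrightarrow> t = b \<or> t \<le> a"
  shows "rev (sorted_list_of_multiset M) ! 1 = a"
proof -
  define N where "N = M - {#b#} - {#a#}"
  have "b \<in># M" using assms(1) by (metis count_inI zero_neq_one)
  then have M: "M = add_mset b (add_mset a N)"
    using assms(2,3) unfolding N_def
    by (metis insert_DiffM insert_noteq_member order_less_irrefl)
  have "b \<notin># N"
    using assms(1,3) unfolding M by (simp add: not_in_iff split: if_splits)
  then have le: "t \<le> a" if "t \<in># N" for t
    using assms(4)[of t] that unfolding M by auto
  have "sorted_list_of_multiset M = sorted_list_of_multiset (mset (sorted_list_of_multiset N @ [a, b]))"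
    by (simp add: M add_mset_commute)
  also have "\<dots> = sorted_list_of_multiset N @ [a, b]"
    unfolding sorted_list_of_multiset_mset using le assms(3)
    by (intro sorted_sort_id) (fastforce simp: sorted_append)
  finally show ?thesis by simp
qed

section \<open>Reversible chains on a finite set\<close>

lemma expectation_pmf_cong:
  fixes f g :: "'a \<Rightarrow> real"
  assumes "\<And>x. x \<in> set_pmf p \<Longrightarrow> f x = g x"
  shows "measure_pmf.expectation p f = measure_pmf.expectation p g"
  using assms by (intro integral_cong_AE) (auto simp: AE_measure_pmf_iff)

section \<open>Functions on the states, with the inner product weighted by the target\<close>

locale finite_target =
  fixes S :: "'a set" and p :: "'a pmf"
  assumes finite_states: "finite S" and set_pmf_target: "set_pmf p = S"
begin

definition mean :: "('a \<Rightarrow> real) \<Rightarrow> real" where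
  "mean \<phi> = (\<Sum>x\<in>S. pmf p x * \<phi> x)"

definition ip :: "('a \<Rightarrow> real) \<Rightarrow> ('a \<Rightarrow> real) \<Rightarrow> real" where
  "ip \<phi> \<psi> = (\<Sum>x\<in>S. pmf p x * (\<phi> x * \<psi> x))"

lemma weight_pos: "x \<in> S \<Longrightarrow> pmf p x > 0"
  using set_pmf_target by (auto simp: pmf_positive)

lemma sum_weights: "(\<Sum>x\<in>S. pmf p x) = 1"
  using finite_states set_pmf_target by (simp add: sum_pmf_eq_1)

lemma states_nonempty: "S \<noteq> {}"
  using set_pmf_target set_pmf_not_empty by metis

lemma expectation_eq_mean: "measure_pmf.expectation p \<phi> = mean \<phi>"
  using integral_measure_pmf_real[of S p \<phi>] finite_states set_pmf_target
  by (simp add: mean_def mult.commute)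

lemma mean_const: "mean (\<lambda>_. a) = a"
  by (simp add: mean_def sum_weights flip: sum_distrib_right)

lemma mean_diff: "mean (\<lambda>x. \<phi> x - \<psi> x) = mean \<phi> - mean \<psi>"
  by (simp add: mean_def algebra_simps sum_subtractf)

lemma mean_add: "mean (\<lambda>x. \<phi> x + \<psi> x) = mean \<phi> + mean \<psi>"
  by (simp add: mean_def algebra_simps sum.distrib)

lemma mean_mult: "mean (\<lambda>x. a * \<phi> x) = a * mean \<phi>"
  by (simp add: mean_def algebra_simps sum_distrib_left)

lemmas mean_simps = mean_const mean_diff mean_add mean_mult

lemma mean_cong: "(\<And>x. x \<in> S \<Longrightarrow> \<phi> x = \<psi> x) \<Longrightarrow> mean \<phi> = mean \<psi>"
  by (simp add: mean_def)

lemma ip_eq_mean: "ip \<phi> \<psi> = mean (\<lambda>x. \<phi> x * \<psi> x)"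
  by (simp add: ip_def mean_def)

lemma ip_cong:
  "(\<And>x. x \<in> S \<Longrightarrow> \<phi> x = \<phi>' x) \<Longrightarrow> (\<And>x. x \<in> S \<Longrightarrow> \<psi> x = \<psi>' x) \<Longrightarrow> ip \<phi> \<psi> = ip \<phi>' \<psi>'"
  by (simp add: ip_def)

lemma ip_commute: "ip \<phi> \<psi> = ip \<psi> \<phi>"
  by (simp add: ip_def mult.commute)

lemma ip_diff_right: "ip \<phi> (\<lambda>x. \<psi> x - \<rho> x) = ip \<phi> \<psi> - ip \<phi> \<rho>"
  by (simp add: ip_def algebra_simps sum_subtractf)

lemma ip_diff_left: "ip (\<lambda>x. \<psi> x - \<rho> x) \<phi> = ip \<psi> \<phi> - ip \<rho> \<phi>"
  by (simp add: ip_def algebra_simps sum_subtractf)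

lemma ip_add_right: "ip \<phi> (\<lambda>x. \<psi> x + \<rho> x) = ip \<phi> \<psi> + ip \<phi> \<rho>"
  by (simp add: ip_def algebra_simps sum.distrib)

lemma ip_add_left: "ip (\<lambda>x. \<psi> x + \<rho> x) \<phi> = ip \<psi> \<phi> + ip \<rho> \<phi>"
  by (simp add: ip_def algebra_simps sum.distrib)

lemma ip_mult_right: "ip \<phi> (\<lambda>x. a * \<psi> x) = a * ip \<phi> \<psi>"
  by (simp add: ip_def algebra_simps sum_distrib_left)

lemma ip_mult_left: "ip (\<lambda>x. a * \<psi> x) \<phi> = a * ip \<psi> \<phi>"
  by (simp add: ip_def algebra_simps sum_distrib_left)

lemmas ip_simps = ip_diff_right ip_diff_left ip_add_right ip_add_left ip_mult_right ip_mult_left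

lemma ip_nonneg: "ip \<phi> \<phi> \<ge> 0"
  by (simp add: ip_def sum_nonneg)

lemma ip_eq_0_iff: "ip \<phi> \<phi> = 0 \<longleftrightarrow> (\<forall>x\<in>S. \<phi> x = 0)"
proof -
  have "ip \<phi> \<phi> = 0 \<longleftrightarrow> (\<forall>x\<in>S. pmf p x * (\<phi> x * \<phi> x) = 0)"
    unfolding ip_def using finite_states by (intro sum_nonneg_eq_0_iff) auto
  also have "\<dots> \<longleftrightarrow> (\<forall>x\<in>S. \<phi> x = 0)"
    using weight_pos by force
  finally show ?thesis .
qed

end

text \<open>\<open>connected\<close> is irreducibility, expressed through functions that are
  constant along transitions. A vanishing Dirichlet form gives exactly such a function, so no paths
  have to be handled.\<close>

locale reversible_chain = finite_target S p for S :: "'a set" and p +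
  fixes Q :: "'a \<Rightarrow> 'a pmf"
  assumes closed: "x \<in> S \<Longrightarrow> set_pmf (Q x) \<subseteq> S"
    and reversible: "x \<in> S \<Longrightarrow> y \<in> S \<Longrightarrow> pmf p x * pmf (Q x) y = pmf p y * pmf (Q y) x"
    and connected: "(\<And>x y. x \<in> S \<Longrightarrow> y \<in> S \<Longrightarrow> pmf (Q x) y > 0 \<Longrightarrow> \<phi> x = (\<phi> y :: real)) \<Longrightarrow>
      x \<in> S \<Longrightarrow> y \<in> S \<Longrightarrow> \<phi> x = \<phi> y"
begin

definition step :: "('a \<Rightarrow> real) \<Rightarrow> 'a \<Rightarrow> real" where
  "step \<phi> x = (\<Sum>y\<in>S. pmf (Q x) y * \<phi> y)"

definition dirichlet :: "('a \<Rightarrow> real) \<Rightarrow> ('a \<Rightarrow> real) \<Rightarrow> real" where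
  "dirichlet \<phi> \<psi> = ip \<phi> \<psi> - ip \<phi> (step \<psi>)"

lemma sum_kernel: "x \<in> S \<Longrightarrow> (\<Sum>y\<in>S. pmf (Q x) y) = 1"
  using finite_states closed by (simp add: sum_pmf_eq_1)

lemma step_diff: "step (\<lambda>x. \<phi> x - \<psi> x) = (\<lambda>x. step \<phi> x - step \<psi> x)"
  by (simp add: fun_eq_iff step_def algebra_simps sum_subtractf)

lemma step_add: "step (\<lambda>x. \<phi> x + \<psi> x) = (\<lambda>x. step \<phi> x + step \<psi> x)"
  by (simp add: fun_eq_iff step_def algebra_simps sum.distrib)

lemma step_mult: "step (\<lambda>x. a * \<phi> x) = (\<lambda>x. a * step \<phi> x)"
  by (simp add: fun_eq_iff step_def algebra_simps sum_distrib_left)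

lemma step_cong: "(\<And>x. x \<in> S \<Longrightarrow> \<phi> x = \<psi> x) \<Longrightarrow> step \<phi> = step \<psi>"
  by (simp add: fun_eq_iff step_def)

lemma step_const: "x \<in> S \<Longrightarrow> step (\<lambda>_. a) x = a"
  by (simp add: step_def sum_kernel flip: sum_distrib_right)

lemma ip_step: "ip \<phi> (step \<psi>) = (\<Sum>x\<in>S. \<Sum>y\<in>S. pmf p x * pmf (Q x) y * (\<phi> x * \<psi> y))"
  by (simp add: ip_def step_def sum_distrib_left mult_ac)

text \<open>Detailed balance makes the weights \<open>pmf p x * pmf (Q x) y\<close>
  symmetric.\<close>

lemma ip_step_commute: "ip \<phi> (step \<psi>) = ip (step \<phi>) \<psi>"
proof -
  have "ip \<phi> (step \<psi>) = (\<Sum>y\<in>S. \<Sum>x\<in>S. pmf p x * pmf (Q x) y * (\<phi> x * \<psi> y))"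
    unfolding ip_step by (rule sum.swap)
  also have "\<dots> = (\<Sum>y\<in>S. \<Sum>x\<in>S. pmf p y * pmf (Q y) x * (\<psi> y * \<phi> x))"
    using reversible by (intro sum.cong refl) (simp add: mult_ac)
  also have "\<dots> = ip \<psi> (step \<phi>)"
    unfolding ip_step ..
  finally show ?thesis by (simp only: ip_commute)
qed

lemma mean_step: "mean (step \<phi>) = mean \<phi>"
proof -
  have "mean (step \<phi>) = ip (\<lambda>_. 1) (step \<phi>)"
    by (simp add: ip_eq_mean)
  also have "\<dots> = ip (step (\<lambda>_. 1)) \<phi>"
    by (rule ip_step_commute)
  also have "\<dots> = mean \<phi>"
    unfolding ip_eq_mean by (intro mean_cong) (simp add: step_const)
  finally show ?thesis .
qed

section \<open>The Dirichlet form and the Poisson equation\<close>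

lemma dirichlet_commute: "dirichlet \<phi> \<psi> = dirichlet \<psi> \<phi>"
  by (simp add: dirichlet_def ip_commute[of \<phi> \<psi>] ip_step_commute[of \<phi> \<psi>] ip_commute[of "step \<phi>" \<psi>])

text \<open>After expanding the square, one square term sums to \<open>ip \<phi> \<phi>\<close>
  because rows sum to 1, the other by reversibility. The diagonal contributes zero, so holding
  probabilities do not enter.\<close>

lemma dirichlet_eq:
  "dirichlet \<phi> \<phi> = (\<Sum>x\<in>S. \<Sum>y\<in>S - {x}. pmf p x * pmf (Q x) y * (\<phi> x - \<phi> y)\<^sup>2) / 2"
proof -
  let ?w = "\<lambda>x y. pmf p x * pmf (Q x) y"
  have A: "(\<Sum>x\<in>S. \<Sum>y\<in>S. ?w x y * (\<phi> x)\<^sup>2) = ip \<phi> \<phi>"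
  proof -
    have "(\<Sum>y\<in>S. ?w x y * (\<phi> x)\<^sup>2) = pmf p x * (\<phi> x * \<phi> x)" if "x \<in> S" for x
    proof -
      have "(\<Sum>y\<in>S. ?w x y * (\<phi> x)\<^sup>2) = (\<Sum>y\<in>S. pmf (Q x) y) * (pmf p x * (\<phi> x)\<^sup>2)"
        unfolding sum_distrib_right by (simp add: mult_ac)
      then show ?thesis by (simp add: sum_kernel that power2_eq_square)
    qed
    then show ?thesis by (simp add: ip_def)
  qed
  have "(\<Sum>x\<in>S. \<Sum>y\<in>S. ?w x y * (\<phi> y)\<^sup>2) = (\<Sum>y\<in>S. \<Sum>x\<in>S. ?w x y * (\<phi> y)\<^sup>2)"
    by (rule sum.swap)
  also have "\<dots> = (\<Sum>y\<in>S. \<Sum>x\<in>S. ?w y x * (\<phi> y)\<^sup>2)"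
    using reversible by (intro sum.cong refl) simp
  finally have B: "(\<Sum>x\<in>S. \<Sum>y\<in>S. ?w x y * (\<phi> y)\<^sup>2) = ip \<phi> \<phi>"
    unfolding A .
  have "(\<Sum>x\<in>S. \<Sum>y\<in>S - {x}. ?w x y * (\<phi> x - \<phi> y)\<^sup>2) = (\<Sum>x\<in>S. \<Sum>y\<in>S. ?w x y * (\<phi> x - \<phi> y)\<^sup>2)"
    using finite_states by (intro sum.cong refl sum.mono_neutral_left) auto
  also have "\<dots> = (\<Sum>x\<in>S. \<Sum>y\<in>S. ?w x y * (\<phi> x)\<^sup>2 + ?w x y * (\<phi> y)\<^sup>2 - 2 * (?w x y * (\<phi> x * \<phi> y)))"
    by (intro sum.cong refl) (simp add: power2_eq_square algebra_simps)
  also have "\<dots> = 2 * dirichlet \<phi> \<phi>"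
    by (simp add: sum.distrib sum_subtractf A B dirichlet_def ip_step flip: sum_distrib_left)
  finally show ?thesis by simp
qed

lemma dirichlet_nonneg: "dirichlet \<phi> \<phi> \<ge> 0"
  unfolding dirichlet_eq by (intro divide_nonneg_nonneg sum_nonneg) auto

text \<open>A sum of nonnegative terms that is at most zero has only zero terms, so
  \<open>\<phi>\<close> agrees across every transition of positive probability.\<close>

lemma dirichlet_le_0_imp_const:
  assumes "dirichlet \<phi> \<phi> \<le> 0" "x \<in> S" "y \<in> S"
  shows "\<phi> x = \<phi> y"
proof (rule connected[OF _ assms(2,3)])
  fix x y assume xy: "x \<in> S" "y \<in> S" "pmf (Q x) y > 0"
  define F where "F x y = pmf p x * pmf (Q x) y * (\<phi> x - \<phi> y)\<^sup>2" for x y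
  have F: "F x y \<ge> 0" for x y
    by (simp add: F_def)
  have "(\<Sum>x\<in>S. \<Sum>y\<in>S - {x}. F x y) = 0"
    using assms(1) dirichlet_nonneg[of \<phi>] unfolding dirichlet_eq F_def by simp
  then have "(\<Sum>y\<in>S - {x}. F x y) = 0"
    using xy(1) finite_states by (simp add: sum_nonneg_eq_0_iff sum_nonneg F)
  then have "x = y \<or> F x y = 0"
    using xy(2) finite_states by (auto simp: sum_nonneg_eq_0_iff F)
  then show "\<phi> x = \<phi> y"
    using xy(3) weight_pos[OF xy(1)] by (auto simp: F_def)
qed

lemma harmonic_mean_0:
  assumes "dirichlet \<phi> \<phi> \<le> 0" "mean \<phi> = 0" "x \<in> S"
  shows "\<phi> x = 0"
proof -
  have "mean \<phi> = mean (\<lambda>_. \<phi> x)"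
    by (intro mean_cong dirichlet_le_0_imp_const[OF assms(1) _ assms(3)])
  then show ?thesis using assms(2) by (simp add: mean_const)
qed

lemma poisson_equation:
  assumes "mean h = 0"
  obtains u where "mean u = 0" "\<And>x. x \<in> S \<Longrightarrow> u x - step u x = h x"
proof -
  \<comment> \<open>Adding the projection onto the constants makes \<open>I - Q\<close> injective.\<close>
  let ?a = "\<lambda>x y. (if x = y then 1 else 0) - pmf (Q x) y + pmf p y"
  have a: "(\<Sum>y\<in>S. ?a x y * \<phi> y) = \<phi> x - step \<phi> x + mean \<phi>" if "x \<in> S" for x \<phi>
  proof -
    have "(\<Sum>y\<in>S. (if x = y then 1 else 0) * \<phi> y) = \<phi> x"
      using that finite_states by (simp add: if_distrib[of "\<lambda>t. t * _"] sum.delta cong: if_cong)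
    then show ?thesis
      by (simp add: step_def mean_def algebra_simps sum.distrib sum_subtractf)
  qed
  \<comment> \<open>Stationarity cancels the means of \<open>\<phi>\<close> and
    \<open>step \<phi>\<close>. A solution of the perturbed system for mean-zero \<open>h\<close>
    therefore has mean zero and solves the Poisson equation itself.\<close>
  have mean_a: "mean (\<lambda>x. \<phi> x - step \<phi> x + mean \<phi>) = mean \<phi>" for \<phi>
    by (simp add: mean_simps mean_step)
  have inj: "\<forall>x\<in>S. \<phi> x = 0" if "\<And>x. x \<in> S \<Longrightarrow> (\<Sum>y\<in>S. ?a x y * \<phi> y) = 0" for \<phi>
  proof -
    have eq: "\<phi> x - step \<phi> x + mean \<phi> = 0" if "x \<in> S" for x
      using \<open>\<And>x. x \<in> S \<Longrightarrow> (\<Sum>y\<in>S. ?a x y * \<phi> y) = 0\<close>[OF that] a[OF that] by simp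
    then have m: "mean \<phi> = 0"
      using mean_cong[of "\<lambda>x. \<phi> x - step \<phi> x + mean \<phi>" "\<lambda>_. 0"] mean_a[of \<phi>] by (simp add: mean_const)
    have "ip \<phi> \<phi> = ip \<phi> (step \<phi>)"
      using eq m by (intro ip_cong) auto
    then show ?thesis
      using harmonic_mean_0[of \<phi>] m by (simp add: dirichlet_def)
  qed
  obtain u where u: "\<forall>x\<in>S. (\<Sum>y\<in>S. ?a x y * u y) = h x"
    using injective_imp_solvable_on[of S ?a h, OF finite_states inj] by (rule exE)
  then have eq: "u x - step u x + mean u = h x" if "x \<in> S" for x
    using a[OF that, of u] that by simp
  have "mean u = mean h"
    using mean_a[of u] mean_cong[OF eq] by simp
  then show thesis
    using assms eq by (intro that[of u]) auto
qed

subsection \<open>Asymptotic variance\<close>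

lemma path_from_support:
  assumes "x \<in> S"
  shows "finite (set_pmf (path_from Q T x))" "\<And>xs. xs \<in> set_pmf (path_from Q T x) \<Longrightarrow> length xs = T"
proof -
  have "finite (set_pmf (path_from Q T x)) \<and> (\<forall>xs\<in>set_pmf (path_from Q T x). length xs = T)"
    using assms
  proof (induction T arbitrary: x)
    case (Suc T)
    have "finite (set_pmf (Q x))"
      using closed[OF Suc.prems] finite_states finite_subset by blast
    then show ?case
      using Suc.IH closed[OF Suc.prems] by (auto simp: subset_iff)
  qed simp
  then show "finite (set_pmf (path_from Q T x))"
    "\<And>xs. xs \<in> set_pmf (path_from Q T x) \<Longrightarrow> length xs = T"
    by auto
qed

lemma expectation_path_from_Suc:
  fixes F :: "'a list \<Rightarrow> real"
  assumes "x \<in> S"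
  shows "measure_pmf.expectation (path_from Q (Suc T) x) F =
    step (\<lambda>y. measure_pmf.expectation (path_from Q T y) (\<lambda>xs. F (x # xs))) x"
  using closed[OF assms] path_from_support(1) finite_states
  by (simp add: step_def pmf_expectation_bind[of S])

lemma expectation_path_law:
  fixes F :: "'a list \<Rightarrow> real"
  shows "measure_pmf.expectation (path_law p Q T) F =
    mean (\<lambda>x. measure_pmf.expectation (path_from Q T x) F)"
  using path_from_support(1) finite_states set_pmf_target
  by (simp add: path_law_def mean_def pmf_expectation_bind[of S])

lemma path_law_support:
  shows "finite (set_pmf (path_law p Q T))" "\<And>xs. xs \<in> set_pmf (path_law p Q T) \<Longrightarrow> length xs = T"
  using path_from_support finite_states set_pmf_target by (auto simp: path_law_def)

context
  fixes h u :: "'a \<Rightarrow> real"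
  assumes poisson: "\<And>x. x \<in> S \<Longrightarrow> u x - step u x = h x"
begin

text \<open>Since \<open>h = u - step u\<close> on \<open>S\<close>, the iterates of
  \<open>step\<close> applied to \<open>h\<close> telescope. The path includes its starting point,
  so the powers run from 0 to \<open>T - 1\<close>.\<close>

lemma expectation_path_sum:
  assumes "x \<in> S"
  shows "measure_pmf.expectation (path_from Q T x) (\<lambda>xs. \<Sum>y\<leftarrow>xs. h y) = u x - (step ^^ T) u x"
  using assms
proof (induction T arbitrary: x)
  case (Suc T)
  have "measure_pmf.expectation (path_from Q (Suc T) x) (\<lambda>xs. \<Sum>y\<leftarrow>xs. h y) =
      step (\<lambda>y. measure_pmf.expectation (path_from Q T y) (\<lambda>xs. h x + (\<Sum>z\<leftarrow>xs. h z))) x"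
    using Suc.prems by (simp add: expectation_path_from_Suc del: path_from.simps)
  also have "\<dots> = step (\<lambda>y. h x + (u y - (step ^^ T) u y)) x"
    using Suc.IH path_from_support(1)
    by (intro fun_cong[OF step_cong])
       (subst Bochner_Integration.integral_add, auto simp: integrable_measure_pmf_finite)
  also have "\<dots> = h x + (step u x - (step ^^ Suc T) u x)"
    by (simp add: step_add step_diff step_const Suc.prems)
  also have "\<dots> = u x - (step ^^ Suc T) u x"
    using poisson[OF Suc.prems] by simp
  finally show ?case .
qed simp

text \<open>Conditioning on the first state splits the square into its own square, a cross term
  evaluated by \<open>expectation_path_sum\<close>, and the second moment of a path shorter by one,
  which again starts in \<open>p\<close> by stationarity.\<close>

lemma second_moment_path_sum:
  "measure_pmf.expectation (path_law p Q T) (\<lambda>xs. (\<Sum>y\<leftarrow>xs. h y)\<^sup>2) =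
    real T * (2 * ip h u - ip h h) - 2 * (ip u (step u) - ip u ((step ^^ Suc T) u))"
proof (induction T)
  case 0
  then show ?case by (simp add: expectation_path_law mean_const)
next
  case (Suc T)
  let ?X = "\<lambda>xs. \<Sum>y\<leftarrow>xs. h y"
  let ?E = "\<lambda>y. measure_pmf.expectation (path_from Q T y) ?X"
  let ?M = "\<lambda>y. measure_pmf.expectation (path_from Q T y) (\<lambda>xs. (?X xs)\<^sup>2)"
  let ?W = "\<lambda>n. (step ^^ n) u"
  have "measure_pmf.expectation (path_from Q (Suc T) x) (\<lambda>xs. (?X xs)\<^sup>2) =
      h x * h x + 2 * (h x * (u x - h x - ?W (Suc T) x)) + step ?M x" if x: "x \<in> S" for x
  proof -
    have "measure_pmf.expectation (path_from Q (Suc T) x) (\<lambda>xs. (?X xs)\<^sup>2) =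
        step (\<lambda>y. measure_pmf.expectation (path_from Q T y) (\<lambda>xs. (h x + ?X xs)\<^sup>2)) x"
      using x by (simp add: expectation_path_from_Suc del: path_from.simps)
    also have "\<dots> = step (\<lambda>y. h x * h x + (2 * h x) * (u y - ?W T y) + ?M y) x"
    proof (intro fun_cong[OF step_cong])
      fix y assume y: "y \<in> S"
      have int: "integrable (measure_pmf (path_from Q T y)) F" for F :: "'a list \<Rightarrow> real"
        using path_from_support(1)[OF y] by (rule integrable_measure_pmf_finite)
      have "measure_pmf.expectation (path_from Q T y) (\<lambda>xs. (h x + ?X xs)\<^sup>2) =
          measure_pmf.expectation (path_from Q T y) (\<lambda>xs. (h x * h x + (2 * h x) * ?X xs) + (?X xs)\<^sup>2)"
        by (simp add: power2_eq_square algebra_simps)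
      also have "\<dots> = h x * h x + (2 * h x) * ?E y + ?M y"
        by (simp add: int Bochner_Integration.integral_add)
      finally show "measure_pmf.expectation (path_from Q T y) (\<lambda>xs. (h x + ?X xs)\<^sup>2) =
          h x * h x + (2 * h x) * (u y - ?W T y) + ?M y"
        using expectation_path_sum[OF y] by simp
    qed
    also have "\<dots> = h x * h x + (2 * h x) * (step u x - ?W (Suc T) x) + step ?M x"
      unfolding step_add step_mult step_diff by (simp add: step_const x)
    also have "step u x = u x - h x"
      using poisson[OF x] by simp
    finally show ?thesis by (simp add: algebra_simps)
  qed
  then have "measure_pmf.expectation (path_law p Q (Suc T)) (\<lambda>xs. (?X xs)\<^sup>2) =
      mean (\<lambda>x. h x * h x + 2 * (h x * (u x - h x - ?W (Suc T) x)) + step ?M x)"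
    unfolding expectation_path_law by (intro mean_cong)
  also have "\<dots> = ip h h + 2 * (ip h u - ip h h - ip h (?W (Suc T))) + mean ?M"
    by (simp add: mean_simps mean_step ip_simps flip: ip_eq_mean)
  \<comment> \<open>Writing \<open>h\<close> as \<open>u - step u\<close> and moving
    \<open>step\<close> to the other side turns this term into a difference of consecutive values of
    \<open>ip u ((step ^^ n) u)\<close>, so the corrections telescope.\<close>
  also have "ip h (?W (Suc T)) = ip (\<lambda>x. u x - step u x) (?W (Suc T))"
    using poisson by (intro ip_cong) auto
  also have "\<dots> = ip u (?W (Suc T)) - ip u (?W (Suc (Suc T)))"
    by (simp add: ip_simps flip: ip_step_commute)
  also have "mean ?M = real T * (2 * ip h u - ip h h) - 2 * (ip u (step u) - ip u (?W (Suc T)))"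
    using Suc.IH unfolding expectation_path_law .
  finally show ?case by (simp add: algebra_simps)
qed

text \<open>Each step is an averaging, so it preserves a uniform bound. Boundedness in
  \<open>n\<close> is enough, since the correction is divided by \<open>T\<close>.\<close>

lemma abs_iterate_step_le:
  assumes "x \<in> S"
  shows "\<bar>(step ^^ n) u x\<bar> \<le> (\<Sum>y\<in>S. \<bar>u y\<bar>)"
  using assms
proof (induction n arbitrary: x)
  case 0
  then show ?case
    using member_le_sum[of x S "\<lambda>y. \<bar>u y\<bar>"] finite_states by simp
next
  case (Suc n)
  have "\<bar>(step ^^ Suc n) u x\<bar> \<le> (\<Sum>y\<in>S. \<bar>pmf (Q x) y * (step ^^ n) u y\<bar>)"
    by (simp add: step_def sum_abs)
  also have "\<dots> \<le> (\<Sum>y\<in>S. pmf (Q x) y * (\<Sum>y\<in>S. \<bar>u y\<bar>))"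
    using Suc.IH by (intro sum_mono) (simp add: abs_mult mult_left_mono)
  also have "\<dots> = (\<Sum>y\<in>S. \<bar>u y\<bar>)"
    using sum_kernel[OF Suc.prems] by (simp flip: sum_distrib_right)
  finally show ?case .
qed

lemma second_moment_rate:
  "(\<lambda>T. measure_pmf.expectation (path_law p Q T) (\<lambda>xs. (\<Sum>y\<leftarrow>xs. h y)\<^sup>2) / real T)
    \<longlonglongrightarrow> 2 * ip h u - ip h h"
proof -
  define C where "C = (\<Sum>x\<in>S. pmf p x * (\<bar>u x\<bar> * (\<Sum>y\<in>S. \<bar>u y\<bar>)))"
  have C: "\<bar>ip u ((step ^^ n) u)\<bar> \<le> C" for n
    unfolding ip_def C_def
    by (rule order_trans[OF sum_abs], intro sum_mono)
       (simp add: abs_mult mult_left_mono abs_iterate_step_le)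
  define e where "e T = 2 * (ip u (step u) - ip u ((step ^^ Suc T) u))" for T
  have "norm (e T / real T) \<le> 4 * C / real T" for T
    using C[of 1] C[of "Suc T"] by (auto simp: e_def abs_divide intro!: divide_right_mono)
  then have "(\<lambda>T. e T / real T) \<longlonglongrightarrow> 0"
    by (intro Lim_null_comparison[OF always_eventually lim_const_over_n] allI)
  then have "(\<lambda>T. (2 * ip h u - ip h h) - e T / real T) \<longlonglongrightarrow> (2 * ip h u - ip h h) - 0"
    by (intro tendsto_diff tendsto_const)
  moreover have "\<forall>\<^sub>F T in sequentially. (2 * ip h u - ip h h) - e T / real T =
      measure_pmf.expectation (path_law p Q T) (\<lambda>xs. (\<Sum>y\<leftarrow>xs. h y)\<^sup>2) / real T"
    \<comment> \<open>At \<open>T = 0\<close> the right-hand quotient is 0 by the convention for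
      division, so the identity is asserted for positive \<open>T\<close> only.\<close>
    using eventually_gt_at_top[of 0]
    by eventually_elim (simp only: second_moment_path_sum e_def, simp add: diff_divide_distrib)
  ultimately show ?thesis
    using Lim_transform_eventually by fastforce
qed

end

text \<open>Every path has length \<open>T\<close>, so centering \<open>h\<close> shifts the sum by
  the constant \<open>T * mean h\<close> and keeps the variance. The centered sum has expectation
  zero because \<open>step\<close> preserves means, so its variance is its second moment.\<close>

lemma asymptotic_variance_eq:
  assumes "\<And>x. x \<in> S \<Longrightarrow> u x - step u x = h x - mean h"
  shows "asymptotic_variance p h Q = 2 * ip (\<lambda>x. h x - mean h) u - target_variance p h"
proof -
  let ?h = "\<lambda>x. h x - mean h"
  have sum_list_centered: "(\<Sum>x\<leftarrow>xs. h x) = (\<Sum>x\<leftarrow>xs. ?h x) + real (length xs) * mean h" for xs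
    by (induction xs) (simp_all add: algebra_simps)
  have mean_0: "measure_pmf.expectation (path_law p Q T) (\<lambda>xs. \<Sum>x\<leftarrow>xs. ?h x) = 0" for T
  proof -
    have "mean ((step ^^ T) u) = mean u"
      by (induction T) (simp_all add: mean_step)
    then show ?thesis
      unfolding expectation_path_law
      using mean_cong[OF expectation_path_sum[OF assms]] by (simp add: mean_diff)
  qed
  have "measure_pmf.variance (path_law p Q T) (\<lambda>xs. \<Sum>x\<leftarrow>xs. h x) =
      measure_pmf.expectation (path_law p Q T) (\<lambda>xs. (\<Sum>x\<leftarrow>xs. ?h x)\<^sup>2)" for T
  proof -
    have "measure_pmf.expectation (path_law p Q T) (\<lambda>xs. \<Sum>x\<leftarrow>xs. h x) =
        measure_pmf.expectation (path_law p Q T) (\<lambda>xs. (\<Sum>x\<leftarrow>xs. ?h x) + real T * mean h)"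
      by (intro expectation_pmf_cong) (subst sum_list_centered, simp add: path_law_support)
    also have "\<dots> = real T * mean h"
      using path_law_support(1) mean_0
      by (subst Bochner_Integration.integral_add) (auto simp: integrable_measure_pmf_finite)
    finally have E: "measure_pmf.expectation (path_law p Q T) (\<lambda>xs. \<Sum>x\<leftarrow>xs. h x) = real T * mean h" .
    show ?thesis
      unfolding E by (intro expectation_pmf_cong) (subst sum_list_centered, simp add: path_law_support)
  qed
  then have "asymptotic_variance p h Q = 2 * ip ?h u - ip ?h ?h"
    unfolding asymptotic_variance_def using second_moment_rate[OF assms] by (simp add: limI)
  moreover have "ip ?h ?h = target_variance p h"
  proof -
    have "ip ?h ?h = mean (\<lambda>x. (h x)\<^sup>2 - 2 * mean h * h x + (mean h)\<^sup>2)"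
      unfolding ip_eq_mean by (intro mean_cong) (simp add: power2_eq_square algebra_simps)
    also have "\<dots> = mean (\<lambda>x. (h x)\<^sup>2) - (mean h)\<^sup>2"
      by (simp add: mean_simps power2_eq_square)
    finally show ?thesis
      by (simp add: target_variance_def expectation_eq_mean)
  qed
  ultimately show ?thesis by simp
qed

subsection \<open>Spectral gap\<close>

text \<open>The Rayleigh quotient attains its maximum on mean-zero functions by compactness, and a
  vanishing first variation is the eigenvalue equation.\<close>

lemma extremal_eigenfunction:
  assumes "card S \<ge> 2"
  obtains \<phi> \<mu> where "mean \<phi> = 0" "ip \<phi> \<phi> = 1" "\<And>x. x \<in> S \<Longrightarrow> step \<phi> x = \<mu> * \<phi> x"
    "\<And>\<psi>. mean \<psi> = 0 \<Longrightarrow> ip \<psi> (step \<psi>) \<le> \<mu> * ip \<psi> \<psi>"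
proof -
  \<comment> \<open>The bound comes from
    \<open>pmf p x * (\<psi> x)^2 \<le> ip \<psi> \<psi> = 1\<close>. Off \<open>S\<close> the
    weight is 0 and so is its \<open>inverse\<close>; hence \<open>b x = 0\<close> and the box
    contains only functions vanishing off \<open>S\<close>. As a product of compact intervals it is
    compact even over an infinite type.\<close>
  define b where "b x = sqrt (inverse (pmf p x))" for x
  define M where "M = {\<phi>. mean \<phi> = 0} \<inter> {\<phi>. ip \<phi> \<phi> = 1} \<inter> (\<Pi>\<^sub>E x\<in>UNIV. {- b x..b x})"
  have cont: "continuous_on UNIV (\<lambda>\<phi>::'a \<Rightarrow> real. \<phi> x)" for x
    by simp
  have "compactin (product_topology (\<lambda>_. euclidean) UNIV) (\<Pi>\<^sub>E x\<in>UNIV. {- b x..b x})"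
    unfolding compactin_PiE by simp
  then have "compact (\<Pi>\<^sub>E x\<in>UNIV. {- b x..b x})"
    by (metis compactin_euclidean_iff euclidean_product_topology)
  moreover have "closed {\<phi>. mean \<phi> = 0}"
    unfolding mean_def by (intro closed_Collect_eq continuous_intros cont)
  moreover have "closed {\<phi>. ip \<phi> \<phi> = 1}"
    unfolding ip_def by (intro closed_Collect_eq continuous_intros cont)
  ultimately have "compact M"
    unfolding M_def by (intro closed_Int_compact closed_Int)
  have restrict_mem: "(\<lambda>x. if x \<in> S then \<psi> x else 0) \<in> M" if "mean \<psi> = 0" "ip \<psi> \<psi> = 1" for \<psi>
  proof -
    let ?r = "\<lambda>x. if x \<in> S then \<psi> x else 0"
    have "\<bar>\<psi> x\<bar> \<le> b x" if "x \<in> S" for x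
    proof -
      have "pmf p x * (\<psi> x * \<psi> x) \<le> ip \<psi> \<psi>"
        unfolding ip_def using finite_states that
        by (intro member_le_sum[of x S "\<lambda>x. pmf p x * (\<psi> x * \<psi> x)"]) auto
      then have "(\<psi> x)\<^sup>2 \<le> inverse (pmf p x)"
        using \<open>ip \<psi> \<psi> = 1\<close> weight_pos[OF that] by (simp add: field_simps power2_eq_square)
      then show ?thesis
        unfolding b_def by (rule real_le_rsqrt[of "\<bar>\<psi> x\<bar>", simplified])
    qed
    moreover have "b x \<ge> 0" for x
      by (simp add: b_def)
    ultimately have "?r \<in> (\<Pi>\<^sub>E x\<in>UNIV. {- b x..b x})"
      by (auto simp: abs_le_iff PiE_iff minus_le_iff)
    moreover have "mean ?r = mean \<psi>" "ip ?r ?r = ip \<psi> \<psi>"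
      by (auto intro!: mean_cong ip_cong)
    ultimately show ?thesis
      using that by (simp add: M_def)
  qed
  have normalize: "(\<lambda>x. if x \<in> S then inverse (sqrt (ip \<psi> \<psi>)) * \<psi> x else 0) \<in> M"
    if "mean \<psi> = 0" "ip \<psi> \<psi> \<noteq> 0" for \<psi>
  proof (rule restrict_mem)
    show "ip (\<lambda>x. inverse (sqrt (ip \<psi> \<psi>)) * \<psi> x) (\<lambda>x. inverse (sqrt (ip \<psi> \<psi>)) * \<psi> x) = 1"
      unfolding ip_simps using that ip_nonneg[of \<psi>] by (simp add: field_simps)
  qed (simp add: mean_simps that)
  obtain z z' where z: "z \<in> S" "z' \<in> S" "z \<noteq> z'"
    using assms by (auto simp: numeral_2_eq_2 card_le_Suc_iff)
  \<comment> \<open>The centered indicator of one state; a second state makes it nonconstant on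
    \<open>S\<close>, so the constraint set is nonempty.\<close>
  define \<theta> where "\<theta> x = (if x = z then 1 else 0) - mean (\<lambda>x. if x = z then 1 else 0)" for x
  have "mean \<theta> = 0"
    unfolding \<theta>_def by (simp add: mean_simps)
  moreover have "ip \<theta> \<theta> \<noteq> 0"
  proof
    assume "ip \<theta> \<theta> = 0"
    then have "\<theta> z = \<theta> z'" using z by (simp add: ip_eq_0_iff)
    then show False using z by (simp add: \<theta>_def)
  qed
  ultimately have "M \<noteq> {}"
    using normalize[of \<theta>] by blast
  have "continuous_on M (\<lambda>\<phi>. ip \<phi> (step \<phi>))"
    unfolding ip_def step_def
    by (intro continuous_intros continuous_on_subset[OF cont subset_UNIV])
  then obtain \<phi> where "\<phi> \<in> M" and max: "\<And>\<psi>. \<psi> \<in> M \<Longrightarrow> ip \<psi> (step \<psi>) \<le> ip \<phi> (step \<phi>)"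
    using continuous_attains_sup[OF \<open>compact M\<close> \<open>M \<noteq> {}\<close>] by blast
  then have \<phi>: "mean \<phi> = 0" "ip \<phi> \<phi> = 1"
    by (auto simp: M_def)
  define \<mu> where "\<mu> = ip \<phi> (step \<phi>)"
  have bound: "ip \<psi> (step \<psi>) \<le> \<mu> * ip \<psi> \<psi>" if "mean \<psi> = 0" for \<psi>
  proof (cases "ip \<psi> \<psi> = 0")
    case True
    then have "ip \<psi> (step \<psi>) = ip (\<lambda>_. 0) (step \<psi>)"
      by (intro ip_cong) (auto simp: ip_eq_0_iff)
    then show ?thesis using True by (simp add: ip_def)
  next
    case False
    let ?a = "inverse (sqrt (ip \<psi> \<psi>))"
    let ?r = "\<lambda>x. if x \<in> S then ?a * \<psi> x else 0"
    have "ip ?r (step ?r) = ip (\<lambda>x. ?a * \<psi> x) (step (\<lambda>x. ?a * \<psi> x))"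
      by (subst step_cong[of ?r "\<lambda>x. ?a * \<psi> x"]) (auto intro!: ip_cong)
    also have "\<dots> = ip \<psi> (step \<psi>) / ip \<psi> \<psi>"
      unfolding step_mult ip_simps using ip_nonneg[of \<psi>] by (simp add: field_simps)
    finally have "ip \<psi> (step \<psi>) / ip \<psi> \<psi> \<le> \<mu>"
      using max[OF normalize[OF that False]] by (simp add: \<mu>_def)
    then show ?thesis
      using False ip_nonneg[of \<psi>] by (simp add: divide_le_eq)
  qed
  define e where "e x = \<mu> * \<phi> x - step \<phi> x" for x
  have e: "mean e = 0"
    unfolding e_def by (simp add: mean_simps mean_step \<phi>)
  have "ip e e = ip e (\<lambda>x. \<mu> * \<phi> x - step \<phi> x)"
    by (intro ip_cong) (simp_all add: e_def)
  then have ee: "ip e e = \<mu> * ip e \<phi> - ip e (step \<phi>)"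
    by (simp add: ip_simps)
  define R where "R = \<mu> * ip e e - ip e (step e)"
  \<comment> \<open>The quadratic form \<open>\<mu> ip \<psi> \<psi> - ip \<psi> (step \<psi>)\<close> is nonnegative on mean-zero functions and vanishes
    at \<open>\<phi>\<close>, so its derivative at \<open>\<phi>\<close> in the direction \<open>e\<close>, which is \<open>2 * ip e e\<close>, vanishes.\<close>
  have "0 \<le> 2 * t * ip e e + t\<^sup>2 * R" for t
  proof -
    let ?f = "\<lambda>x. \<phi> x + t * e x"
    have "ip \<phi> (step e) = ip e (step \<phi>)"
      by (metis ip_commute ip_step_commute)
    then have "\<mu> * ip ?f ?f - ip ?f (step ?f) =
        2 * t * (\<mu> * ip e \<phi> - ip e (step \<phi>)) + t\<^sup>2 * R"
      by (simp add: step_add step_mult ip_simps \<phi> R_def \<mu>_def[symmetric] ip_commute[of \<phi> e]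
          power2_eq_square algebra_simps)
    also have "\<mu> * ip e \<phi> - ip e (step \<phi>) = ip e e"
      by (rule ee[symmetric])
    finally show ?thesis
      using bound[of ?f] by (simp add: mean_simps \<phi> e)
  qed
  note quad = this
  have "ip e e = 0"
  proof (rule ccontr)
    assume "ip e e \<noteq> 0"
    then have pos: "ip e e > 0" using ip_nonneg[of e] by simp
    \<comment> \<open>Small enough that \<open>\<bar>t * R\<bar> \<le> ip e e\<close>, so the linear
      term wins; the added 1 keeps the denominator positive.\<close>
    define t where "t = - ip e e / (\<bar>R\<bar> + 1)"
    have "t < 0" using pos by (simp add: t_def divide_neg_pos)
    moreover have "0 < 2 * ip e e + t * R"
    proof -
      have "\<bar>t * R\<bar> \<le> ip e e"
        using pos by (simp add: t_def abs_mult abs_divide field_simps)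
      then show ?thesis using pos by linarith
    qed
    ultimately have "t * (2 * ip e e + t * R) < 0"
      by (simp add: mult_neg_pos)
    then show False
      using quad[of t] by (simp add: power2_eq_square algebra_simps)
  qed
  then have "\<forall>x\<in>S. step \<phi> x = \<mu> * \<phi> x"
    by (simp add: ip_eq_0_iff e_def)
  then show thesis
    using that[OF \<phi> _ bound] by blast
qed

text \<open>The derivative of the characteristic polynomial at 1 is a sum over the states of the characteristic
  polynomials of the chain killed at that state, and these have no root in \<open>[1, \<infinity>)\<close>.\<close>

lemma order_char_poly_1: "order 1 (char_poly (transition_matrix S Q)) = 1"
proof -
  let ?k = "\<lambda>x y. pmf (Q x) y"
  let ?A = "mat_on S ?k" and ?n = "card S"
  have A: "transition_matrix S Q = ?A"
    by (simp add: transition_matrix_def mat_on_def)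
  have "?n > 0"
    using finite_states states_nonempty by (simp add: card_gt_0_iff)
  have nz: "char_poly ?A \<noteq> 0"
    using degree_monic_char_poly[OF mat_on_carrier, of S ?k] by auto
  have "eigenvalue ?A 1"
    unfolding eigenvalue_mat_on_iff[OF finite_states]
    using states_nonempty sum_kernel by (intro exI[of _ "\<lambda>_. 1"]) auto
  then have root: "poly (char_poly ?A) 1 = 0"
    by (simp add: eigenvalue_root_char_poly[OF mat_on_carrier])
  have pos: "poly (char_poly (mat_erase ?A i i)) 1 > 0" if i: "i < ?n" for i
  proof (rule monic_poly_pos)
    let ?B = "mat_erase ?A i i"
    define z where "z = from_nat_into S i"
    have z: "z \<in> S"
      unfolding z_def using states_nonempty by (rule from_nat_into)
    have B: "?B \<in> carrier_mat ?n ?n"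
      by simp
    show "lead_coeff (char_poly ?B) = 1"
      using degree_monic_char_poly[OF B] by simp
    fix t :: real assume "t \<ge> 1"
    have "\<not> eigenvalue ?B t"
    proof
      assume "eigenvalue ?B t"
      then obtain \<psi> where nonzero: "\<exists>x\<in>S. \<psi> x \<noteq> 0"
        and eig: "\<And>x. x \<in> S \<Longrightarrow> (\<Sum>y\<in>S. (if x = z \<or> y = z then 0 else ?k x y) * \<psi> y) = t * \<psi> x"
        unfolding mat_erase_mat_on[OF finite_states i] eigenvalue_mat_on_iff[OF finite_states] z_def
        by blast
      \<comment> \<open>Row \<open>z\<close> of the erased matrix is zero while
        \<open>t \<ge> 1\<close>, so the eigenfunction vanishes at \<open>z\<close>. Elsewhere it
        satisfies the eigenvalue equation of the original chain, which makes its Dirichlet form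
        nonpositive and the function constant on \<open>S\<close>, hence zero.\<close>
      have \<psi>z: "\<psi> z = 0"
        using eig[OF z] \<open>t \<ge> 1\<close> by simp
      have "\<psi> x * step \<psi> x = \<psi> x * (t * \<psi> x)" if x: "x \<in> S" for x
      proof (cases "x = z")
        case False
        then have "step \<psi> x = (\<Sum>y\<in>S. (if x = z \<or> y = z then 0 else ?k x y) * \<psi> y)"
          unfolding step_def using \<psi>z by (intro sum.cong) auto
        then show ?thesis using eig[OF x] by simp
      qed (simp add: \<psi>z)
      then have "ip \<psi> (step \<psi>) = ip \<psi> (\<lambda>x. t * \<psi> x)"
        unfolding ip_eq_mean by (rule mean_cong)
      then have "dirichlet \<psi> \<psi> = (1 - t) * ip \<psi> \<psi>"
        by (simp add: dirichlet_def ip_simps algebra_simps)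
      then have "dirichlet \<psi> \<psi> \<le> 0"
        using \<open>t \<ge> 1\<close> ip_nonneg[of \<psi>] by (simp add: mult_nonpos_nonneg)
      then show False
        using nonzero dirichlet_le_0_imp_const[OF _ _ z, of \<psi>] \<psi>z by metis
    qed
    then show "poly (char_poly ?B) t \<noteq> 0"
      by (simp add: eigenvalue_root_char_poly[OF B])
  qed
  \<comment> \<open>Each erased matrix keeps dimension \<open>?n\<close> and has a zero row, so its
    characteristic polynomial carries an extra factor \<open>X\<close>. The factor
    \<open>monom 1 1\<close> accounts for it and equals 1 at the point 1.\<close>
  have "poly (pderiv (char_poly ?A)) 1 = poly (monom 1 1 * pderiv (char_poly ?A)) 1"
    by (simp add: poly_monom)
  also have "\<dots> = (\<Sum>i<?n. poly (char_poly (mat_erase ?A i i)) 1)"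
    unfolding pderiv_char_poly_mat_erase[OF mat_on_carrier] by (simp add: poly_sum)
  also have "\<dots> > 0"
    using pos \<open>?n > 0\<close> by (intro sum_pos) auto
  finally have "order 1 (pderiv (char_poly ?A)) = 0"
    by (intro order_0I) simp
  then show ?thesis
    unfolding A using order_pderiv[OF nz root] by simp
qed

text \<open>By stationarity an eigenfunction whose eigenvalue is not 1 has mean zero, so the
  Rayleigh bound applies to it. As 1 is a simple root, the maximal Rayleigh quotient is then the
  second entry of the list.\<close>

lemma spectral_gap_eq:
  assumes "card S \<ge> 2"
  obtains \<phi> where "mean \<phi> = 0" "ip \<phi> \<phi> = 1" "dirichlet \<phi> \<phi> = spectral_gap S Q"
    "\<And>\<psi>. mean \<psi> = 0 \<Longrightarrow> spectral_gap S Q * ip \<psi> \<psi> \<le> dirichlet \<psi> \<psi>"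
proof -
  obtain \<phi> \<mu> where \<phi>: "mean \<phi> = 0" "ip \<phi> \<phi> = 1"
    and eig: "\<And>x. x \<in> S \<Longrightarrow> step \<phi> x = \<mu> * \<phi> x"
    and bound: "\<And>\<psi>. mean \<psi> = 0 \<Longrightarrow> ip \<psi> (step \<psi>) \<le> \<mu> * ip \<psi> \<psi>"
    using extremal_eigenfunction[OF assms] by blast
  let ?A = "transition_matrix S Q"
  have A: "?A = mat_on S (\<lambda>x y. pmf (Q x) y)"
    by (simp add: transition_matrix_def mat_on_def)
  have carrier: "?A \<in> carrier_mat (card S) (card S)"
    unfolding A by simp
  have nz: "char_poly ?A \<noteq> 0"
    using degree_monic_char_poly[OF carrier] by auto
  have root_iff: "t \<in># proots (char_poly ?A) \<longleftrightarrow>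
      (\<exists>\<psi>. (\<exists>x\<in>S. \<psi> x \<noteq> 0) \<and> (\<forall>x\<in>S. step \<psi> x = t * \<psi> x))" for t
    using nz eigenvalue_root_char_poly[OF carrier, of t]
    by (simp add: A eigenvalue_mat_on_iff[OF finite_states] step_def)
  have nonzero: "\<exists>x\<in>S. \<phi> x \<noteq> 0"
    using \<phi>(2) ip_eq_0_iff[of \<phi>] by auto
  have "ip \<phi> (step \<phi>) = ip \<phi> (\<lambda>x. \<mu> * \<phi> x)"
    using eig by (intro ip_cong) auto
  then have dir: "dirichlet \<phi> \<phi> = 1 - \<mu>"
    by (simp add: dirichlet_def ip_simps \<phi>)
  have "\<mu> < 1"
    using nonzero harmonic_mean_0[of \<phi>] \<phi>(1) dir by force
  have "eigenvalues_desc ?A ! 1 = \<mu>"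
    unfolding eigenvalues_desc_def
  proof (rule nth_rev_sorted_list_of_multiset)
    show "count (proots (char_poly ?A)) 1 = 1"
      using order_char_poly_1 nz by simp
    show "\<mu> \<in># proots (char_poly ?A)"
      unfolding root_iff using nonzero eig by blast
    fix t assume "t \<in># proots (char_poly ?A)"
    then obtain \<psi> where \<psi>: "\<exists>x\<in>S. \<psi> x \<noteq> 0" "\<And>x. x \<in> S \<Longrightarrow> step \<psi> x = t * \<psi> x"
      unfolding root_iff by blast
    show "t = 1 \<or> t \<le> \<mu>"
    proof (cases "mean \<psi> = 0")
      case True
      have "ip \<psi> (step \<psi>) = ip \<psi> (\<lambda>x. t * \<psi> x)"
        using \<psi>(2) by (intro ip_cong) auto
      then have "t * ip \<psi> \<psi> \<le> \<mu> * ip \<psi> \<psi>"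
        using bound[OF True] by (simp add: ip_simps)
      moreover have "ip \<psi> \<psi> > 0"
        using \<psi>(1) ip_eq_0_iff[of \<psi>] ip_nonneg[of \<psi>] by force
      ultimately show ?thesis by simp
    next
      case False
      have "mean (step \<psi>) = mean (\<lambda>x. t * \<psi> x)"
        using \<psi>(2) by (rule mean_cong)
      then show ?thesis using False by (simp add: mean_step mean_simps)
    qed
  qed fact
  then have gap: "spectral_gap S Q = 1 - \<mu>"
    by (simp add: spectral_gap_def)
  show thesis
  proof (rule that[OF \<phi>])
    show "dirichlet \<phi> \<phi> = spectral_gap S Q"
      by (simp add: dir gap)
    show "spectral_gap S Q * ip \<psi> \<psi> \<le> dirichlet \<psi> \<psi>" if "mean \<psi> = 0" for \<psi>
      using bound[OF that] by (simp add: gap dirichlet_def algebra_simps)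
  qed
qed

end

section \<open>Comparison of chains\<close>

text \<open>Peskun's ordering of reversible chains, relaxed by a factor \<open>c\<close>; the
  diagonal is left unconstrained.\<close>

locale dominated_chains =
  Q: reversible_chain S p Q + K: reversible_chain S p K
  for S :: "'a set" and p :: "'a pmf" and Q K :: "'a \<Rightarrow> 'a pmf" +
  fixes c :: real
  assumes c_pos: "c > 0"
    and dominated: "x \<in> S \<Longrightarrow> y \<in> S \<Longrightarrow> x \<noteq> y \<Longrightarrow> c * pmf (Q x) y \<le> pmf (K x) y"
begin

lemma dirichlet_le: "c * Q.dirichlet \<phi> \<phi> \<le> K.dirichlet \<phi> \<phi>"
proof -
  have "c * (\<Sum>x\<in>S. \<Sum>y\<in>S - {x}. pmf p x * pmf (Q x) y * (\<phi> x - \<phi> y)\<^sup>2) =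
      (\<Sum>x\<in>S. \<Sum>y\<in>S - {x}. pmf p x * (c * pmf (Q x) y) * (\<phi> x - \<phi> y)\<^sup>2)"
    by (simp add: sum_distrib_left mult_ac)
  also have "\<dots> \<le> (\<Sum>x\<in>S. \<Sum>y\<in>S - {x}. pmf p x * pmf (K x) y * (\<phi> x - \<phi> y)\<^sup>2)"
    using dominated by (intro sum_mono mult_right_mono mult_left_mono) auto
  finally show ?thesis
    unfolding Q.dirichlet_eq K.dirichlet_eq by simp
qed

text \<open>Let \<open>u\<close> and \<open>v\<close> be the Poisson solutions for \<open>Q\<close>
  and \<open>K\<close>. The function \<open>c * v\<close> is a competitor in the variational problem
  solved by \<open>u\<close>; equivalently, the form of \<open>Q\<close> is nonnegative at
  \<open>u - c * v\<close>.\<close>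

lemma asymptotic_variance_le:
  "asymptotic_variance p h K \<le> asymptotic_variance p h Q / c + (1 - c) / c * target_variance p h"
proof -
  let ?h = "\<lambda>x. h x - Q.mean h"
  have "Q.mean ?h = 0"
    by (simp add: Q.mean_simps)
  then obtain u v where u: "\<And>x. x \<in> S \<Longrightarrow> u x - Q.step u x = ?h x"
    and v: "\<And>x. x \<in> S \<Longrightarrow> v x - K.step v x = ?h x"
    using Q.poisson_equation[of ?h] K.poisson_equation[of ?h] by metis
  have Qu: "Q.dirichlet \<phi> u = Q.ip ?h \<phi>" for \<phi>
  proof -
    have "Q.ip \<phi> (\<lambda>x. u x - Q.step u x) = Q.ip \<phi> ?h"
      using u by (intro Q.ip_cong) auto
    then show ?thesis by (simp add: Q.dirichlet_def Q.ip_simps Q.ip_commute)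
  qed
  have Kv: "K.dirichlet v v = Q.ip ?h v"
  proof -
    have "Q.ip v (\<lambda>x. v x - K.step v x) = Q.ip v ?h"
      using v by (intro Q.ip_cong) auto
    then show ?thesis by (simp add: K.dirichlet_def Q.ip_simps Q.ip_commute)
  qed
  have "0 \<le> Q.dirichlet (\<lambda>x. u x - c * v x) (\<lambda>x. u x - c * v x)"
    by (rule Q.dirichlet_nonneg)
  also have "\<dots> = Q.dirichlet u u - c * Q.dirichlet v u - c * Q.dirichlet u v + c * c * Q.dirichlet v v"
    by (simp add: Q.dirichlet_def Q.step_diff Q.step_mult Q.ip_simps algebra_simps)
  also have "\<dots> = Q.ip ?h u - 2 * c * Q.ip ?h v + c * (c * Q.dirichlet v v)"
    by (simp add: Qu Q.dirichlet_commute[of u v])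
  also have "\<dots> \<le> Q.ip ?h u - 2 * c * Q.ip ?h v + c * Q.ip ?h v"
    using mult_left_mono[OF dirichlet_le[of v], of c] c_pos by (simp add: Kv)
  finally have "Q.ip ?h v \<le> Q.ip ?h u / c"
    using c_pos by (simp add: field_simps)
  \<comment> \<open>With \<open>V\<close> the target variance,
    \<open>- V = - V / c + (1 - c) / c * V\<close>. Only the inner product scales by
    \<open>1 / c\<close>, and the mismatch in \<open>V\<close> is the second term of the
    bound.\<close>
  then have "2 * Q.ip ?h v - target_variance p h \<le>
      (2 * Q.ip ?h u - target_variance p h) / c + (1 - c) / c * target_variance p h"
    using c_pos by (simp add: field_simps)
  then show ?thesis
    using Q.asymptotic_variance_eq[OF u] K.asymptotic_variance_eq[OF v] by simp
qed

text \<open>An extremal function of \<open>K\<close> is a competitor in the variational problem for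
  \<open>Q\<close>.\<close>

lemma spectral_gap_ge:
  assumes "card S \<ge> 2"
  shows "c * spectral_gap S Q \<le> spectral_gap S K"
proof -
  obtain \<phi> where \<phi>: "Q.mean \<phi> = 0" "Q.ip \<phi> \<phi> = 1" "K.dirichlet \<phi> \<phi> = spectral_gap S K"
    using K.spectral_gap_eq[OF assms] by blast
  have "spectral_gap S Q * Q.ip \<phi> \<phi> \<le> Q.dirichlet \<phi> \<phi>"
    using Q.spectral_gap_eq[OF assms] \<phi>(1) by blast
  then have "c * spectral_gap S Q \<le> c * Q.dirichlet \<phi> \<phi>"
    using c_pos by (simp add: \<phi>(2))
  then show ?thesis
    using dirichlet_le[of \<phi>] \<phi>(3) by simp
qed

end

section \<open>Metropolis-Hastings with exponential proposals\<close>

text \<open>The accepted flow is a minimum that is symmetric in \<open>x\<close> and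
  \<open>y\<close>, which gives detailed balance, and monotone in the proposal, which passes lower
  bounds in both directions on to the kernel.\<close>

lemma mh_kernel_flow:
  assumes "finite S" "set_pmf p = S" "x \<in> S" "y \<in> S" "x \<noteq> y"
    and q: "\<And>y z. 0 \<le> q y z" "\<And>y. y \<notin> S \<Longrightarrow> q y x = 0" "(\<Sum>y\<in>S. q y x) \<le> 1"
    and sym: "q y x = 0 \<Longrightarrow> q x y = 0"
  shows "pmf p x * pmf (mh_kernel S p q x) y = min (pmf p x * q y x) (pmf p y * q x y)"
proof -
  have p: "pmf p x > 0"
    using assms(2,3) by (auto simp: pmf_positive)
  have K: "pmf (mh_kernel S p q x) y = mh_move p q y x"
    using assms by (subst pmf_mh_kernel) auto
  show ?thesis
  proof (cases "q y x > 0")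
    case True
    then have pos: "pmf p x * q y x > 0" using p by simp
    have "pmf p x * mh_move p q y x = (pmf p x * q y x) * min 1 (pmf p y * q x y / (pmf p x * q y x))"
      using True by (simp add: mh_move_def)
    also have "\<dots> = min (pmf p x * q y x) (pmf p y * q x y)"
      using pos p True by (subst min_mult_distrib_left) auto
    finally show ?thesis unfolding K .
  next
    case False
    then have "q y x = 0" using q(1)[of y x] by simp
    then show ?thesis using sym by (simp add: K mh_move_def)
  qed
qed

text \<open>Common form of both proposals with log-weight \<open>w x y\<close>; comparing them
  reduces to comparing exponents.\<close>

definition exp_proposal :: "('a \<Rightarrow> 'a set) \<Rightarrow> ('a \<Rightarrow> 'a \<Rightarrow> real) \<Rightarrow> 'a \<Rightarrow> 'a \<Rightarrow> real" where
  "exp_proposal H w y x = exp (w x y) * indicator (H x) y / (\<Sum>z\<in>H x. exp (w x z))"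

lemma balanced_proposal_eq: "balanced_proposal H f = exp_proposal H (\<lambda>x y. (f y - f x) / 2)"
  by (simp add: fun_eq_iff balanced_proposal_def exp_proposal_def)

lemma gradient_proposal_eq:
  "gradient_proposal H g = exp_proposal H (\<lambda>x y. inner (g x) (y - x) / 2)"
  by (simp add: fun_eq_iff gradient_proposal_def exp_proposal_def)

lemma exp_proposal_nonneg: "exp_proposal H w y x \<ge> 0"
  by (simp add: exp_proposal_def sum_nonneg)

lemma exp_proposal_pos_iff:
  assumes "finite (H x)"
  shows "exp_proposal H w y x > 0 \<longleftrightarrow> y \<in> H x"
proof (cases "y \<in> H x")
  case True
  then have "(\<Sum>z\<in>H x. exp (w x z)) > 0"
    using assms by (intro sum_pos) auto
  then show ?thesis using True by (simp add: exp_proposal_def)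
qed (simp add: exp_proposal_def)

text \<open>An inequality rather than an equality, because the sum is 0 when \<open>H x\<close> is
  empty.\<close>

lemma sum_exp_proposal_le:
  assumes "finite S" "H x \<subseteq> S"
  shows "(\<Sum>y\<in>S. exp_proposal H w y x) \<le> 1"
proof -
  have "(\<Sum>y\<in>S. exp_proposal H w y x) = (\<Sum>y\<in>H x. exp (w x y) / (\<Sum>z\<in>H x. exp (w x z)))"
    using assms by (intro sum.mono_neutral_cong_right) (auto simp: exp_proposal_def)
  also have "\<dots> \<le> 1"
    by (simp flip: sum_divide_distrib)
  finally show ?thesis .
qed

text \<open>The factor \<open>exp (- b)\<close> is lost once in the numerator and once in the normalizing sum.\<close>

lemma exp_proposal_ge:
  fixes w w' :: "'a \<Rightarrow> 'a \<Rightarrow> real"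
  assumes "finite (H x)" "\<And>y. y \<in> H x \<Longrightarrow> \<bar>w' x y - w x y\<bar> \<le> b"
  shows "exp (- (2 * b)) * exp_proposal H w y x \<le> exp_proposal H w' y x"
proof (cases "y \<in> H x")
  case True
  let ?Z = "\<lambda>w. \<Sum>z\<in>H x. exp (w x z)"
  have pos: "?Z w > 0" for w :: "'a \<Rightarrow> 'a \<Rightarrow> real"
    using assms(1) True by (intro sum_pos) auto
  have "?Z w' \<le> (\<Sum>z\<in>H x. exp b * exp (w x z))"
    using assms(2) by (intro sum_mono) (force simp flip: exp_add simp: abs_le_iff)
  then have Z: "?Z w' \<le> exp b * ?Z w"
    by (simp add: sum_distrib_left)
  have "exp (- b) * exp (w x y) \<le> exp (w' x y)"
    using assms(2)[OF True] by (simp flip: exp_add add: abs_le_iff)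
  then have "exp (- b) * exp (w x y) / (exp b * ?Z w) \<le> exp (w' x y) / ?Z w'"
    using Z pos by (intro frac_le) auto
  moreover have "exp (- (2 * b)) = exp (- b) / exp b"
    by (simp flip: exp_diff)
  ultimately show ?thesis
    using True by (simp add: exp_proposal_def)
qed (simp add: exp_proposal_def)

section \<open>Metropolis-Hastings chains on a symmetric connected neighbourhood graph\<close>

locale neighbourhood_system = finite_target S p for S :: "'a set" and p +
  fixes H :: "'a \<Rightarrow> 'a set"
  assumes H_subset: "x \<in> S \<Longrightarrow> H x \<subseteq> S"
    and H_sym: "x \<in> S \<Longrightarrow> y \<in> H x \<Longrightarrow> x \<in> H y"
    and H_connected: "(\<And>x y. x \<in> S \<Longrightarrow> y \<in> H x \<Longrightarrow> \<phi> x = (\<phi> y :: real)) \<Longrightarrow>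
      x \<in> S \<Longrightarrow> y \<in> S \<Longrightarrow> \<phi> x = \<phi> y"
begin

lemma finite_H: "x \<in> S \<Longrightarrow> finite (H x)"
  using H_subset finite_states finite_subset by blast

lemma proposal_eq_0: "y \<notin> H x \<Longrightarrow> exp_proposal H w y x = 0"
  by (simp add: exp_proposal_def)

lemma flow:
  assumes "x \<in> S" "y \<in> S" "x \<noteq> y"
  shows "pmf p x * pmf (mh_kernel S p (exp_proposal H w) x) y =
    min (pmf p x * exp_proposal H w y x) (pmf p y * exp_proposal H w x y)"
proof (rule mh_kernel_flow)
  show "exp_proposal H w x y = 0" if "exp_proposal H w y x = 0"
  proof -
    have "y \<notin> H x"
      using that exp_proposal_pos_iff[of H x w y, OF finite_H[OF assms(1)]] by auto
    then show ?thesis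
      using H_sym[OF assms(2)] by (intro proposal_eq_0) blast
  qed
  show "exp_proposal H w y x = 0" if "y \<notin> S" for y
    using that H_subset[OF assms(1)] by (intro proposal_eq_0) blast
qed (use assms finite_states set_pmf_target H_subset in
  \<open>auto simp: exp_proposal_nonneg sum_exp_proposal_le\<close>)

lemma mh_chain: "reversible_chain S p (mh_kernel S p (exp_proposal H w))"
proof
  let ?q = "exp_proposal H w"
  let ?K = "mh_kernel S p ?q"
  show "set_pmf (?K x) \<subseteq> S" if x: "x \<in> S" for x
  proof -
    have zero: "?q y x = 0" if "y \<notin> S" for y
      using that H_subset[OF x] by (intro proposal_eq_0) blast
    have "pmf (?K x) y = 0" if "y \<notin> S" for y
      using that x zero finite_states H_subset[OF x]
      by (subst pmf_mh_kernel) (auto simp: exp_proposal_nonneg sum_exp_proposal_le mh_move_def)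
    then show ?thesis
      by (auto simp: set_pmf_eq)
  qed
  show "pmf p x * pmf (?K x) y = pmf p y * pmf (?K y) x" if "x \<in> S" "y \<in> S" for x y
  proof (cases "x = y")
    case False
    then show ?thesis
      using flow[OF that False] flow[OF that(2,1)] by (simp add: min.commute)
  qed simp
  fix \<phi> :: "'a \<Rightarrow> real" and x y
  assume inv: "\<And>x y. x \<in> S \<Longrightarrow> y \<in> S \<Longrightarrow> pmf (?K x) y > 0 \<Longrightarrow> \<phi> x = \<phi> y" and xy: "x \<in> S" "y \<in> S"
  show "\<phi> x = \<phi> y"
  proof (rule H_connected[OF _ xy])
    fix x y assume x: "x \<in> S" and yH: "y \<in> H x"
    then have y: "y \<in> S" using H_subset by blast
    show "\<phi> x = \<phi> y"
    proof (cases "x = y")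
      case False
      have "?q y x > 0" "?q x y > 0"
        using exp_proposal_pos_iff[OF finite_H] H_sym x y yH by auto
      then have "pmf p x * pmf (?K x) y > 0"
        using weight_pos x y by (subst flow[OF x y False]) auto
      then have "pmf (?K x) y > 0"
        using weight_pos[OF x] by (simp add: zero_less_mult_iff)
      then show ?thesis by (rule inv[OF x y])
    qed simp
  qed
qed

text \<open>The minimum in \<open>flow\<close> is monotone and commutes with multiplication by a
  positive factor, so a factor lost by the proposals in both directions is lost only once by the
  kernel.\<close>

lemma dominated_mh_chains:
  assumes close: "\<And>x y. x \<in> S \<Longrightarrow> y \<in> H x \<Longrightarrow> \<bar>w' x y - w x y\<bar> \<le> b"
  shows "dominated_chains S p (mh_kernel S p (exp_proposal H w))
    (mh_kernel S p (exp_proposal H w')) (exp (- (2 * b)))"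
proof -
  let ?c = "exp (- (2 * b))"
  interpret Q: reversible_chain S p "mh_kernel S p (exp_proposal H w)"
    by (rule mh_chain)
  interpret K: reversible_chain S p "mh_kernel S p (exp_proposal H w')"
    by (rule mh_chain)
  show ?thesis
  proof
    fix x y assume xy: "x \<in> S" "y \<in> S" "x \<noteq> y"
    let ?q = "exp_proposal H w" and ?q' = "exp_proposal H w'"
    have ge: "?c * ?q y x \<le> ?q' y x" if "x \<in> S" for x y
      using finite_H[OF that] close[OF that] by (rule exp_proposal_ge)
    have "pmf p x * (?c * pmf (mh_kernel S p ?q x) y) = ?c * min (pmf p x * ?q y x) (pmf p y * ?q x y)"
      using flow[OF xy, of w] by (simp add: mult_ac)
    also have "\<dots> = min (pmf p x * (?c * ?q y x)) (pmf p y * (?c * ?q x y))"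
      by (subst min_mult_distrib_left) (simp add: mult_ac)
    also have "\<dots> \<le> min (pmf p x * ?q' y x) (pmf p y * ?q' x y)"
      using ge[OF xy(1), of y] ge[OF xy(2), of x] by (intro min.mono mult_left_mono) auto
    also have "\<dots> = pmf p x * pmf (mh_kernel S p ?q' x) y"
      using flow[OF xy, of w'] by simp
    finally show "?c * pmf (mh_kernel S p ?q x) y \<le> pmf (mh_kernel S p ?q' x) y"
      using weight_pos[OF xy(1)] by simp
  qed simp
qed

end

section \<open>Smooth functions\<close>

lemma GDERIV_has_real_derivative_line:
  assumes "GDERIV f (x + t *\<^sub>R d) :> D"
  shows "((\<lambda>t. f (x + t *\<^sub>R d)) has_real_derivative inner D d) (at t)"
proof -
  have "((\<lambda>t. f (x + t *\<^sub>R d)) has_derivative (\<lambda>s. inner D (s *\<^sub>R d))) (at t)"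
    using assms unfolding gderiv_def
    by (intro has_derivative_compose[where g = f and f = "\<lambda>t. x + t *\<^sub>R d"])
       (auto intro!: derivative_eq_intros simp: inner_commute)
  then show ?thesis
    by (simp add: has_field_derivative_def mult.commute[of _ "inner D d"])
qed

text \<open>Up to the constant \<open>f x\<close>, \<open>\<psi>\<close> is the Taylor remainder
  along the segment minus its bound. Cauchy-Schwarz and the Lipschitz estimate make its derivative
  nonpositive, which replaces the integral form of the remainder.\<close>

lemma L_smooth_upper:
  fixes f :: "'a::real_inner \<Rightarrow> real"
  assumes "L_smooth f g L"
  shows "f (x + d) - f x - inner (g x) d \<le> L / 2 * (norm d)\<^sup>2"
proof -
  define \<psi> where "\<psi> t = f (x + t *\<^sub>R d) - t * inner (g x) d - L / 2 * t\<^sup>2 * (norm d)\<^sup>2" for t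
  have "\<psi> 1 \<le> \<psi> 0"
  proof (rule DERIV_nonpos_imp_nonincreasing[where f = \<psi> and a = 0 and b = 1])
    fix t :: real assume t: "0 \<le> t" "t \<le> 1"
    let ?D = "inner (g (x + t *\<^sub>R d)) d - inner (g x) d - L * t * (norm d)\<^sup>2"
    have "(\<psi> has_real_derivative ?D) (at t)"
      unfolding \<psi>_def using assms
      by (auto simp: L_smooth_def intro!: derivative_eq_intros GDERIV_has_real_derivative_line)
    moreover have "?D \<le> 0"
    proof -
      have lip: "norm (g (x + t *\<^sub>R d) - g x) \<le> L * norm (x + t *\<^sub>R d - x)"
        using assms unfolding L_smooth_def by blast
      have "inner (g (x + t *\<^sub>R d) - g x) d \<le> norm (g (x + t *\<^sub>R d) - g x) * norm d"
        by (rule norm_cauchy_schwarz)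
      also have "\<dots> \<le> (L * norm (x + t *\<^sub>R d - x)) * norm d"
        by (rule mult_right_mono[OF lip norm_ge_zero])
      finally show ?thesis
        using t by (simp add: inner_diff_left power2_eq_square mult_ac)
    qed
    ultimately show "\<exists>y. DERIV \<psi> t :> y \<and> y \<le> 0" by blast
  qed simp
  then show ?thesis by (simp add: \<psi>_def)
qed

text \<open>Turns the upper Taylor estimate into the lower one.\<close>

lemma L_smooth_minus: "L_smooth f g L \<Longrightarrow> L_smooth (\<lambda>x. - f x) (\<lambda>x. - g x) L"
  by (auto simp: L_smooth_def norm_minus_commute intro: GDERIV_minus)

lemma L_smooth_taylor:
  assumes "L_smooth f g L"
  shows "\<bar>f y - f x - inner (g x) (y - x)\<bar> \<le> L / 2 * (norm (y - x))\<^sup>2"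
  unfolding abs_le_iff
  using L_smooth_upper[OF assms, of x "y - x"] L_smooth_upper[OF L_smooth_minus[OF assms], of x "y - x"]
  by simp

text \<open>The Lipschitz inequality at two distinct points forces the sign of \<open>L\<close>,
  which is used when a distance is replaced by the larger radius.\<close>

lemma L_smooth_constant_nonneg:
  fixes f :: "'a::real_inner \<Rightarrow> real" and u v :: 'a
  assumes "L_smooth f g L" "u \<noteq> v"
  shows "L \<ge> 0"
proof -
  have "norm (g u - g v) \<le> L * norm (u - v)"
    using assms(1) unfolding L_smooth_def by blast
  then have "0 \<le> L * norm (u - v)"
    by (rule order_trans[OF norm_ge_zero])
  then show ?thesis using assms(2) by (simp add: zero_le_mult_iff)
qed

section \<open>Hamming balls in product spaces\<close>

definition product_states :: "'a set \<Rightarrow> ('a ^ 'd) set" where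
  "product_states A = {x. \<forall>i. x $ i \<in> A}"

lemma binary_states_eq: "binary_states = product_states {0, 1}"
  by (auto simp: binary_states_def product_states_def)

lemma onehot_states_eq: "onehot_states = product_states (range (\<lambda>k. axis k 1))"
  by (auto simp: onehot_states_def product_states_def)

lemma hamming_commute: "hamming x y = hamming y x"
  by (simp add: hamming_def eq_commute)

lemma finite_product_states:
  assumes "finite A"
  shows "finite (product_states A :: ('a ^ 'd) set)"
proof -
  have "product_states A \<subseteq> vec_lambda ` (\<Pi>\<^sub>E i\<in>(UNIV :: 'd set). A)"
  proof
    fix x :: "'a ^ 'd" assume "x \<in> product_states A"
    then show "x \<in> vec_lambda ` (\<Pi>\<^sub>E i\<in>(UNIV :: 'd set). A)"
      by (intro image_eqI[of _ _ "vec_nth x"]) (auto simp: product_states_def)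
  qed
  then show ?thesis
    by (rule finite_subset) (use assms in \<open>auto intro!: finite_PiE\<close>)
qed

text \<open>Equidistance makes the norm between two states depend only on the number of differing
  entries, and a second letter lets every pattern of changes start from every state. Hence all
  centers have the same radius.\<close>

locale equidistant_alphabet =
  fixes A :: "'a::real_inner set" and \<delta> :: real
  assumes finite_alphabet: "finite A" and two_letters: "\<And>a. a \<in> A \<Longrightarrow> \<exists>b\<in>A. b \<noteq> a"
    and alphabet_nonempty: "A \<noteq> {}"
    and equidistant: "a \<in> A \<Longrightarrow> b \<in> A \<Longrightarrow> a \<noteq> b \<Longrightarrow> norm (a - b) = \<delta>"
begin

text \<open>Differing entries are replaced one at a time, which stays within balls as
  \<open>r \<ge> 1\<close>. Each move leaves the current state, so it is allowed under either
  convention for the center.\<close>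

lemma hamming_ball_connected:
  fixes \<phi> :: "'a ^ 'd \<Rightarrow> 'b"
  assumes "r \<ge> 1" and
    inv: "\<And>x y. x \<in> product_states A \<Longrightarrow> y \<in> hamming_ball (product_states A) cen r x \<Longrightarrow> \<phi> x = \<phi> y"
    and "x \<in> product_states A" "y \<in> product_states A"
  shows "\<phi> x = \<phi> y"
  using assms(3)
proof (induction "hamming x y" arbitrary: x)
  case 0
  then have "x = y" by (simp add: hamming_def Finite_Cartesian_Product.vec_eq_iff)
  then show ?case by simp
next
  case (Suc n)
  then have "{i. x $ i \<noteq> y $ i} \<noteq> {}"
    unfolding hamming_def by (metis card.empty nat.distinct(1))
  then obtain i where i: "x $ i \<noteq> y $ i" by blast
  define z where "z = (\<chi> j. if j = i then y $ i else x $ j)"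
  have z: "z \<in> product_states A"
    using Suc.prems assms(4) by (simp add: z_def product_states_def)
  have "{j. x $ j \<noteq> z $ j} = {i}"
    using i by (auto simp: z_def)
  then have xz: "hamming x z = 1"
    by (simp add: hamming_def)
  have "{j. x $ j \<noteq> y $ j} = insert i {j. z $ j \<noteq> y $ j}" "i \<notin> {j. z $ j \<noteq> y $ j}"
    using i by (auto simp: z_def)
  then have "hamming x y = Suc (hamming z y)"
    by (simp add: hamming_def)
  then have "\<phi> z = \<phi> y"
    using Suc.hyps z by simp
  moreover have "x \<noteq> z"
    using i by (auto simp: z_def Finite_Cartesian_Product.vec_eq_iff)
  then have "z \<in> hamming_ball (product_states A) cen r x"
    using z xz assms(1) by (simp add: hamming_ball_def)
  then have "\<phi> x = \<phi> z"
    by (rule inv[OF Suc.prems])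
  ultimately show ?case by simp
qed

lemma norm_le_ball_radius:
  fixes x y x0 :: "'a ^ 'd"
  assumes "x \<in> product_states A" "y \<in> hamming_ball (product_states A) cen r x" "x0 \<in> product_states A"
  shows "norm (y - x) \<le> ball_radius (hamming_ball (product_states A) cen r) x0"
proof -
  let ?S = "product_states A :: ('a ^ 'd) set"
  define other where "other a = (SOME b. b \<in> A \<and> b \<noteq> a)" for a
  have other: "other a \<in> A" "other a \<noteq> a" if "a \<in> A" for a
    using someI_ex[of "\<lambda>b. b \<in> A \<and> b \<noteq> a"] two_letters[OF that] by (auto simp: other_def)
  \<comment> \<open>\<open>y0\<close> differs from \<open>x0\<close> exactly where \<open>y\<close> differs from \<open>x\<close>; this makes the radius independent of
    the center.\<close>
  define y0 where "y0 = (\<chi> i. if x $ i = y $ i then x0 $ i else other (x0 $ i))"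
  have y: "y \<in> ?S" "hamming x y \<le> r" "y = x \<longrightarrow> cen"
    using assms(2) by (auto simp: hamming_ball_def)
  have letters: "x $ i \<in> A" "y $ i \<in> A" "x0 $ i \<in> A" for i
    using assms(1,3) y(1) by (auto simp: product_states_def)
  have neq: "x0 $ i \<noteq> y0 $ i \<longleftrightarrow> x $ i \<noteq> y $ i" for i
    using other(2)[OF letters(3)[of i]] by (auto simp: y0_def)
  have "y0 \<in> ?S"
    using other(1) letters(3) by (simp add: product_states_def y0_def)
  moreover have "hamming x0 y0 = hamming x y"
    by (simp add: hamming_def neq)
  \<comment> \<open>Respects the center convention: \<open>y0\<close> is the center exactly when
    \<open>y\<close> is.\<close>
  moreover have "y0 = x0 \<longleftrightarrow> y = x"
    using neq by (metis Finite_Cartesian_Product.vec_eq_iff)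
  ultimately have mem: "y0 \<in> hamming_ball ?S cen r x0"
    using y by (simp add: hamming_ball_def)
  have "norm (x0 $ i - y0 $ i) = norm (y $ i - x $ i)" for i
  proof (cases "x $ i = y $ i")
    case True
    then show ?thesis by (simp add: y0_def)
  next
    case False
    then show ?thesis
      using equidistant[of "y $ i" "x $ i"] equidistant[of "x0 $ i" "other (x0 $ i)"]
        letters[of i] other[OF letters(3)[of i]] by (simp add: y0_def)
  qed
  then have "norm (y - x) = norm (x0 - y0)"
    by (simp add: norm_vec_def)
  also have "\<dots> \<le> ball_radius (hamming_ball ?S cen r) x0"
    unfolding ball_radius_def
  proof (rule cSUP_upper[OF mem])
    have "finite (hamming_ball ?S cen r x0)"
      by (rule finite_subset[OF _ finite_product_states[OF finite_alphabet]])
         (auto simp: hamming_ball_def)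
    then show "bdd_above ((\<lambda>y. norm (x0 - y)) ` hamming_ball ?S cen r x0)"
      by simp
  qed
  finally show ?thesis .
qed

lemma mh_comparison:
  fixes f :: "'a ^ 'd \<Rightarrow> real" and g :: "'a ^ 'd \<Rightarrow> 'a ^ 'd" and r :: nat and cen :: bool
  defines "S \<equiv> product_states A"
  defines "H \<equiv> hamming_ball S cen r"
  defines "p \<equiv> gibbs S f"
  defines "Q \<equiv> mh_kernel S p (balanced_proposal H f)"
  defines "K \<equiv> mh_kernel S p (gradient_proposal H g)"
  assumes "r \<ge> 1" "x0 \<in> S" "L_smooth f g L"
  defines "c \<equiv> exp (- (1 / 2) * L * (ball_radius H x0)\<^sup>2)"
  shows "(\<forall>h. asymptotic_variance p h K \<le>
            asymptotic_variance p h Q / c + (1 - c) / c * target_variance p h) \<and>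
          spectral_gap S K \<ge> c * spectral_gap S Q"
proof -
  have fin: "finite S"
    unfolding S_def using finite_alphabet by (rule finite_product_states)
  have "S \<noteq> {}" using \<open>x0 \<in> S\<close> by blast
  then have Z: "(\<Sum>y\<in>S. exp (f y)) > 0"
    using fin by (intro sum_pos) auto
  have target: "set_pmf p = S"
    unfolding p_def using fin \<open>S \<noteq> {}\<close> Z by (auto simp: set_pmf_eq pmf_gibbs)
  interpret neighbourhood_system S p H
  proof
    show "\<phi> x = \<phi> y" if "\<And>x y. x \<in> S \<Longrightarrow> y \<in> H x \<Longrightarrow> \<phi> x = \<phi> y" "x \<in> S" "y \<in> S"
      for \<phi> :: "'a ^ 'd \<Rightarrow> real" and x y
      using hamming_ball_connected[OF \<open>r \<ge> 1\<close>, of cen \<phi> x y] that unfolding S_def H_def by blast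
  qed (auto simp: fin target H_def hamming_ball_def hamming_commute)
  obtain a b where ab: "a \<in> A" "b \<in> A" "b \<noteq> a"
    using alphabet_nonempty two_letters by blast
  \<comment> \<open>Two constant vectors serve both as distinct states for
    \<open>card S \<ge> 2\<close> and as distinct points forcing \<open>L \<ge> 0\<close>.\<close>
  let ?u = "(\<chi> i. a) :: 'a ^ 'd" and ?v = "(\<chi> i. b) :: 'a ^ 'd"
  have uv: "?u \<noteq> ?v" "?u \<in> S" "?v \<in> S"
    using ab by (auto simp: S_def product_states_def dest: fun_cong)
  have "card {?u, ?v} \<le> card S"
    using uv fin by (intro card_mono) auto
  then have "card S \<ge> 2"
    using uv(1) by simp
  have "L \<ge> 0"
    using \<open>L_smooth f g L\<close> uv(1) by (rule L_smooth_constant_nonneg)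
  \<comment> \<open>The factor 1/2 in the exponents of the proposals halves the Taylor error, whence
    the 4; the doubling in \<open>dominated_mh_chains\<close> then gives the exponent of
    \<open>c\<close>.\<close>
  have close: "\<bar>inner (g x) (y - x) / 2 - (f y - f x) / 2\<bar> \<le> L * (ball_radius H x0)\<^sup>2 / 4"
    if "x \<in> S" "y \<in> H x" for x y
  proof -
    have "norm (y - x) \<le> ball_radius H x0"
      using norm_le_ball_radius[of x y cen r x0] that \<open>x0 \<in> S\<close> unfolding S_def H_def by blast
    then have "L / 2 * (norm (y - x))\<^sup>2 \<le> L / 2 * (ball_radius H x0)\<^sup>2"
      using \<open>L \<ge> 0\<close> by (intro mult_left_mono power_mono) auto
    then have "\<bar>f y - f x - inner (g x) (y - x)\<bar> \<le> L / 2 * (ball_radius H x0)\<^sup>2"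
      using L_smooth_taylor[OF \<open>L_smooth f g L\<close>, of y x] by (rule order_trans[rotated])
    moreover have "inner (g x) (y - x) / 2 - (f y - f x) / 2 = - (f y - f x - inner (g x) (y - x)) / 2"
      by (simp add: diff_divide_distrib)
    ultimately show ?thesis
      by (simp only: abs_divide abs_minus_cancel) simp
  qed
  have "c = exp (- (2 * (L * (ball_radius H x0)\<^sup>2 / 4)))"
    by (simp add: c_def)
  then interpret dominated_chains S p Q K c
    unfolding Q_def K_def balanced_proposal_eq gradient_proposal_eq
    using dominated_mh_chains[of "\<lambda>x y. inner (g x) (y - x) / 2", OF close] by simp
  show ?thesis
    using asymptotic_variance_le spectral_gap_ge[OF \<open>card S \<ge> 2\<close>] by blast
qed

end

section \<open>The binary and the one-hot alphabet\<close>

lemma equidistant_binary: "equidistant_alphabet {0, 1 :: real} 1"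
  by unfold_locales auto

text \<open>Distinct one-hot vectors are orthogonal unit vectors, hence the distance
  \<open>sqrt 2\<close>.\<close>

lemma equidistant_onehot:
  assumes "CARD('k::finite) \<ge> 2"
  shows "equidistant_alphabet (range (\<lambda>k. axis k 1 :: real ^ 'k)) (sqrt 2)"
proof
  show "\<exists>b\<in>range (\<lambda>k. axis k 1 :: real ^ 'k). b \<noteq> a" if a: "a \<in> range (\<lambda>k. axis k 1 :: real ^ 'k)" for a
  proof -
    obtain k where k: "a = axis k 1" using a by blast
    have "UNIV \<noteq> {k}"
    proof
      assume "UNIV = {k}"
      then have "CARD('k) = card {k}" by simp
      then show False using assms by simp
    qed
    then obtain l where "l \<noteq> k" by blast
    then have "axis l 1 \<noteq> a"
      by (simp add: k axis_eq_axis)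
    then show ?thesis by blast
  qed
  show "norm (a - b) = sqrt 2"
    if mem: "a \<in> range (\<lambda>k. axis k 1 :: real ^ 'k)" "b \<in> range (\<lambda>k. axis k 1)" and "a \<noteq> b" for a b
  proof -
    obtain k l where a: "a = axis k 1" and b: "b = axis l 1" using mem by blast
    then have "k \<noteq> l" using \<open>a \<noteq> b\<close> by blast
    then have "inner (a - b) (a - b) = 2"
      by (simp add: a b inner_diff_left inner_diff_right inner_axis_axis)
    then show ?thesis by (simp add: norm_eq_sqrt_inner)
  qed
qed auto

theorem theorem1:
  fixes r :: nat and L :: real and cen :: bool
  assumes "r \<ge> 1"
  shows
    "(\<forall>(f :: real ^ 'd \<Rightarrow> real) g. \<forall>x0 \<in> binary_states.
      L_smooth f g L \<longrightarrow>
      (let S = binary_states; H = hamming_ball S cen r; p = gibbs S f;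
           Q = mh_kernel S p (balanced_proposal H f);
           Qg = mh_kernel S p (gradient_proposal H g);
           c = exp (- (1 / 2) * L * (ball_radius H x0)\<^sup>2)
       in (\<forall>h. asymptotic_variance p h Qg \<le>
                 asymptotic_variance p h Q / c + (1 - c) / c * target_variance p h) \<and>
          spectral_gap S Qg \<ge> c * spectral_gap S Q)) \<and>
    (\<forall>(f :: real ^ 'k ^ 'd \<Rightarrow> real) g. \<forall>x0 \<in> onehot_states.
      CARD('k) \<ge> 2 \<longrightarrow> L_smooth f g L \<longrightarrow>
      (let S = onehot_states; H = hamming_ball S cen r; p = gibbs S f;
           Q = mh_kernel S p (balanced_proposal H f);
           Qg = mh_kernel S p (gradient_proposal H g);
           c = exp (- (1 / 2) * L * (ball_radius H x0)\<^sup>2)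
       in (\<forall>h. asymptotic_variance p h Qg \<le>
                 asymptotic_variance p h Q / c + (1 - c) / c * target_variance p h) \<and>
          spectral_gap S Qg \<ge> c * spectral_gap S Q))"
  unfolding Let_def binary_states_eq onehot_states_eq
  using equidistant_alphabet.mh_comparison[OF equidistant_binary assms]
    equidistant_alphabet.mh_comparison[OF equidistant_onehot assms]
  by blast

end
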